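(* Let $\mathcal{H}$ be a real Hilbert space, $\mathcal{C}\subset\mathcal{H}$ a nonempty closed convex set, $\mathcal{T}:\mathcal{H}\to\mathcal{H}$ an operator and $h:\mathcal{C}\to\overline{\mathbb{R}}=[-\infty,+\infty]$ a function. Let $S$ denote the set of solutions of the mixed variational inequality, i.e. the set of all $\bar{x}\in\mathcal{C}$ with $\langle \mathcal{T}(\bar{x}),u-\bar{x}\rangle+h(u)-h(\bar{x})\ge 0$ for all $u\in\mathcal{C}$. Suppose that: (1) $S\neq\emptyset$; (2) $\mathcal{T}$ is Lipschitz continuous with constant $\beta>0$; (3) $h$ is proper, lower semicontinuous and convex on $\mathcal{C}$; (4) $\mathcal{T}$ is monotone; in particular, $\mathcal{T}$ and $h$ satisfy the general monotonicity condition $\langle \mathcal{T}(v),v-u\rangle+h(v)-h(u)\ge 0$ for all $v\in\mathcal{C}$ and all $u\in S$; (5) $\mathcal{T}$ is sequentially weakly continuous on $\mathcal{C}$, i.e. $x_n\rightharpoonup \bar{x}$ implies $\mathcal{T}(x_n)\rightharpoonup\mathcal{T}(\bar{x})$. Let $0<\lambda<\dfrac{1}{1+\beta^2}$ and $x_0\in\mathcal{H}$, and let $x(t),y(t)$, $t\in[0,+\infty)$, be the trajectories generated by the dynamical system $$\begin{cases} y(t)=\mathrm{prox}_{\lambda h}\big(x(t)-\lambda\mathcal{T}(x(t))\big),\\ \dot{x}(t)+x(t)=y(t)+\lambda\left[\mathcal{T}(x(t))-\mathcal{T}(y(t))\right],\\ x(0)=x_0.\end{cases}$$ Then $x(t)$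 and $y(t)$ converge weakly to a point of $S$ as $t\to+\infty$.
   Context: Proximal operator: for $\lambda>0$ and $u\in\mathcal{H}$, $\mathrm{prox}_{\lambda h}(u)=\operatorname{arg\,min}_{v\in\mathcal{C}}\{\lambda h(v)+\tfrac12\|u-v\|^2\}$. Proper: $h>-\infty$ everywhere and the effective domain $\mathrm{dom}\,h=\{u: h(u)<+\infty\}$ is nonempty. Convex: $\mathrm{dom}\,h$ is convex and $h(\alpha u+(1-\alpha)v)\le\alpha h(u)+(1-\alpha)h(v)$ for $u,v\in\mathrm{dom}\,h$, $\alpha\in[0,1]$. Elements of $S$ are understood to lie in $\mathrm{dom}\,h$, so that no expression $\infty-\infty$ occurs. Monotone (on $\mathcal{C}$): $\langle\mathcal{T}u-\mathcal{T}v,u-v\rangle\ge0$ for all $u,v\in\mathcal{C}$. The trajectory $x:[0,+\infty)\to\mathcal{H}$ is a strong global solution of the system: $x$ is locally absolutely continuous (absolutely continuous on each interval $[0,\rho]$, $0<\rho<+\infty$), the differential equation holds for almost every $t\in[0,+\infty)$, and $x(0)=x_0$. The symbol $\rightharpoonup$ denotes weak convergence. *)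

theory Defs
  imports "HOL-Analysis.Analysis"
begin

text \<open>
  A real Hilbert space is a type of sort \<open>{real_inner, complete_space}\<close>. A function
  \<open>h : C \<rightarrow> [-\<infinity>, +\<infinity>]\<close> is represented by a total function into \<open>ereal\<close>; all notions below
  look only at its values on \<open>C\<close>.
\<close>

definition eff_dom :: "'a set \<Rightarrow> ('a \<Rightarrow> ereal) \<Rightarrow> 'a set" where
  "eff_dom C h = {u \<in> C. h u < \<infinity>}"

definition proper_on :: "'a set \<Rightarrow> ('a \<Rightarrow> ereal) \<Rightarrow> bool" where
  "proper_on C h \<longleftrightarrow> (\<forall>u\<in>C. h u > -\<infinity>) \<and> eff_dom C h \<noteq> {}"

definition ereal_convex_on :: "'a::real_vector set \<Rightarrow> ('a \<Rightarrow> ereal) \<Rightarrow> bool" where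
  "ereal_convex_on C h \<longleftrightarrow> convex (eff_dom C h) \<and>
     (\<forall>u\<in>eff_dom C h. \<forall>v\<in>eff_dom C h. \<forall>\<alpha>\<in>{0..1::real}.
        h (\<alpha> *\<^sub>R u + (1 - \<alpha>) *\<^sub>R v) \<le> ereal \<alpha> * h u + ereal (1 - \<alpha>) * h v)"

text \<open>
  At an isolated point of \<open>C\<close> the filter \<open>at x within C\<close> is trivial and \<open>Liminf\<close> is \<open>\<infinity>\<close>,
  so the condition is void there, as it should be.
\<close>

definition lsc_on :: "'a::topological_space set \<Rightarrow> ('a \<Rightarrow> ereal) \<Rightarrow> bool" where
  "lsc_on C h \<longleftrightarrow> (\<forall>x\<in>C. h x \<le> Liminf (at x within C) h)"

definition monotone_operator_on :: "'a::real_inner set \<Rightarrow> ('a \<Rightarrow> 'a) \<Rightarrow> bool" where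
  "monotone_operator_on C T \<longleftrightarrow> (\<forall>u\<in>C. \<forall>v\<in>C. (T u - T v) \<bullet> (u - v) \<ge> 0)"

text \<open>Weak convergence along a filter, so that it covers both sequences and \<open>t \<rightarrow> +\<infinity>\<close>.\<close>

definition weakly_converges :: "('i \<Rightarrow> 'a::real_normed_vector) \<Rightarrow> 'a \<Rightarrow> 'i filter \<Rightarrow> bool" where
  "weakly_converges X l F \<longleftrightarrow>
     (\<forall>f :: 'a \<Rightarrow> real. bounded_linear f \<longrightarrow> ((\<lambda>i. f (X i)) \<longlongrightarrow> f l) F)"

definition seq_weakly_continuous_on ::
  "'a::real_normed_vector set \<Rightarrow> ('a \<Rightarrow> 'a) \<Rightarrow> bool" where
  "seq_weakly_continuous_on C T \<longleftrightarrow>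
     (\<forall>X l. (\<forall>n. X n \<in> C) \<and> l \<in> C \<and> weakly_converges X l sequentially
        \<longrightarrow> weakly_converges (\<lambda>n. T (X n)) (T l) sequentially)"

text \<open>
  Solutions lie in the effective domain; for proper \<open>h\<close> the subtracted value \<open>h x\<close> is then a
  real number and no expression \<open>\<infinity> - \<infinity>\<close> occurs.
\<close>

definition mvi_solutions :: "'a::real_inner set \<Rightarrow> ('a \<Rightarrow> 'a) \<Rightarrow> ('a \<Rightarrow> ereal) \<Rightarrow> 'a set" where
  "mvi_solutions C T h =
     {x \<in> eff_dom C h. \<forall>u\<in>C. ereal (T x \<bullet> (u - x)) + h u - h x \<ge> 0}"

text \<open>
  The library's \<open>arg_min_on\<close> chooses some minimiser; for proper, convex, lower semicontinuous
  \<open>h\<close> on a nonempty closed convex \<open>C\<close> the minimiser exists and is unique.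
\<close>

definition prox :: "'a::real_inner set \<Rightarrow> real \<Rightarrow> ('a \<Rightarrow> ereal) \<Rightarrow> 'a \<Rightarrow> 'a" where
  "prox C lam h u = arg_min_on (\<lambda>v. ereal lam * h v + ereal ((norm (u - v))\<^sup>2 / 2)) C"

definition absolutely_continuous_on_ivl ::
  "real \<Rightarrow> real \<Rightarrow> (real \<Rightarrow> 'a::real_normed_vector) \<Rightarrow> bool" where
  "absolutely_continuous_on_ivl c d f \<longleftrightarrow>
     (\<forall>\<epsilon>>0. \<exists>\<delta>>0. \<forall>(n::nat) a b.
        (\<forall>i<n. c \<le> a i \<and> a i \<le> b i \<and> b i \<le> d) \<and>
        disjoint_family_on (\<lambda>i. {a i<..<b i}) {..<n} \<and>
        (\<Sum>i<n. b i - a i) < \<delta>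
        \<longrightarrow> (\<Sum>i<n. norm (f (b i) - f (a i))) < \<epsilon>)"

definition locally_absolutely_continuous :: "(real \<Rightarrow> 'a::real_normed_vector) \<Rightarrow> bool" where
  "locally_absolutely_continuous f \<longleftrightarrow> (\<forall>\<rho>>0. absolutely_continuous_on_ivl 0 \<rho> f)"

text \<open>
  A trajectory \<open>[0, +\<infinity>) \<rightarrow> H\<close> is a total function on the reals of which only the values at
  \<open>t \<ge> 0\<close> matter; in particular the derivative is taken within \<open>{0..}\<close>.
\<close>

definition strong_global_solution ::
  "'a::real_inner set \<Rightarrow> ('a \<Rightarrow> 'a) \<Rightarrow> ('a \<Rightarrow> ereal) \<Rightarrow> real \<Rightarrow> 'a
    \<Rightarrow> (real \<Rightarrow> 'a) \<Rightarrow> (real \<Rightarrow> 'a) \<Rightarrow> bool" where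
  "strong_global_solution C T h lam x\<^sub>0 x y \<longleftrightarrow>
     locally_absolutely_continuous x \<and>
     (\<forall>t\<ge>0. y t = prox C lam h (x t - lam *\<^sub>R T (x t))) \<and>
     (AE t in lebesgue_on {0..}. \<exists>x'. (x has_vector_derivative x') (at t within {0..}) \<and>
        x' + x t = y t + lam *\<^sub>R (T (x t) - T (y t))) \<and>
     x 0 = x\<^sub>0"

text \<open>The general monotonicity condition follows from monotonicity of \<open>T\<close> on \<open>C\<close>.\<close>

lemma general_monotonicity:
  fixes C :: "'a::real_inner set"
  assumes mono: "monotone_operator_on C T"
    and v: "v \<in> C" and u: "u \<in> mvi_solutions C T h"
  shows "ereal (T v \<bullet> (v - u)) + h v - h u \<ge> 0"
proof -
  from u have uC: "u \<in> C" and sol: "ereal (T u \<bullet> (v - u)) + h v - h u \<ge> 0"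
    using v by (auto simp: mvi_solutions_def eff_dom_def)
  have "(T v - T u) \<bullet> (v - u) \<ge> 0"
    using mono v uC by (simp add: monotone_operator_on_def)
  then have "T u \<bullet> (v - u) \<le> T v \<bullet> (v - u)"
    by (simp add: inner_diff_left)
  then have "ereal (T u \<bullet> (v - u)) + h v - h u \<le> ereal (T v \<bullet> (v - u)) + h v - h u"
    by (intro ereal_minus_mono add_mono) auto
  with sol show ?thesis by (rule order_trans)
qed

end

theory Submission
  imports Defs
begin

text \<open>
  For \<open>z \<in> S\<close> the variational inequality of the proximal point \<open>y\<close> and the monotonicity condition at \<open>y\<close>
  give \<open>x' \<bullet> (y - z) \<le> 0\<close>, hence \<open>(\<parallel>x - z\<parallel>\<^sup>2)' \<le> - 2 (1 - \<lambda> \<beta>) \<parallel>x - y\<parallel>\<^sup>2\<close> almost everywhere. So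
  \<open>\<parallel>x - z\<parallel>\<close> decreases, and since \<open>x\<close> and \<open>y\<close> are Lipschitz in time, \<open>x - y \<rightarrow> 0\<close>.

  The limit is found without weak compactness. Let \<open>K\<^sub>n\<close> be the closed convex hull of \<open>{y t | t \<ge> n}\<close>; these
  sets decrease and have a common point. Minty's form of the inequality holds along \<open>y t\<close> up to an error
  tending to \<open>0\<close>, and its approximate solutions form closed convex sets; so every common point lies in \<open>S\<close>.
  Since \<open>\<parallel>y - z\<parallel>\<close> converges for each \<open>z \<in> S\<close>, the common point is unique. If some functional did not
  converge along \<open>y\<close>, the hulls of the offending tails would have a common point different from it.
\<close>

section \<open>Absolutely continuous functions\<close>

lemma absolutely_continuous_on_ivlE:
  assumes ac: "absolutely_continuous_on_ivl a b f" and e: "e > 0"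
  obtains d where "d > 0"
    and "\<And>(n::nat) u v. \<lbrakk>\<And>i. i < n \<Longrightarrow> a \<le> u i \<and> u i \<le> v i \<and> v i \<le> b;
        disjoint_family_on (\<lambda>i. {u i<..<v i}) {..<n}; (\<Sum>i<n. v i - u i) < d\<rbrakk>
        \<Longrightarrow> (\<Sum>i<n. norm (f (v i) - f (u i))) < e"
proof -
  have "\<exists>d>0. \<forall>(n::nat) u v. (\<forall>i<n. a \<le> u i \<and> u i \<le> v i \<and> v i \<le> b) \<and>
        disjoint_family_on (\<lambda>i. {u i<..<v i}) {..<n} \<and> (\<Sum>i<n. v i - u i) < d
        \<longrightarrow> (\<Sum>i<n. norm (f (v i) - f (u i))) < e"
    by (rule ac[unfolded absolutely_continuous_on_ivl_def, THEN spec, THEN mp, OF e])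
  then obtain d where "d > 0" and d: "\<forall>(n::nat) u v. (\<forall>i<n. a \<le> u i \<and> u i \<le> v i \<and> v i \<le> b) \<and>
        disjoint_family_on (\<lambda>i. {u i<..<v i}) {..<n} \<and> (\<Sum>i<n. v i - u i) < d
        \<longrightarrow> (\<Sum>i<n. norm (f (v i) - f (u i))) < e"
    by (elim exE conjE)
  show ?thesis
    by (rule that[OF \<open>d > 0\<close>], rule d[rule_format], intro conjI allI impI) auto
qed

text \<open>Transfers absolute continuity from the trajectory to scalar functions of it: its inner
  product with a fixed vector, and its squared distance to a solution.\<close>

lemma absolutely_continuous_on_ivl_dominated:
  fixes f :: "real \<Rightarrow> 'a::real_normed_vector" and g :: "real \<Rightarrow> 'b::real_normed_vector"
  assumes ac: "absolutely_continuous_on_ivl a b f"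
    and lip: "\<And>s t. s \<in> {a..b} \<Longrightarrow> t \<in> {a..b} \<Longrightarrow> norm (g t - g s) \<le> K * norm (f t - f s)"
  shows "absolutely_continuous_on_ivl a b g"
  unfolding absolutely_continuous_on_ivl_def
proof (intro allI impI)
  fix e :: real assume e: "e > 0"
  \<comment> \<open>\<open>K\<close> may be zero or negative; \<open>\<bar>K\<bar> + 1\<close>
    dominates it and can be divided by.\<close>
  then have "e / (\<bar>K\<bar> + 1) > 0" by simp
  obtain d where d: "d > 0" and D: "\<And>(n::nat) u v. \<lbrakk>\<And>i. i < n \<Longrightarrow> a \<le> u i \<and> u i \<le> v i \<and> v i \<le> b;
        disjoint_family_on (\<lambda>i. {u i<..<v i}) {..<n}; (\<Sum>i<n. v i - u i) < d\<rbrakk>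
        \<Longrightarrow> (\<Sum>i<n. norm (f (v i) - f (u i))) < e / (\<bar>K\<bar> + 1)"
    by (fact absolutely_continuous_on_ivlE[OF ac \<open>e / (\<bar>K\<bar> + 1) > 0\<close>])
  show "\<exists>d>0. \<forall>(n::nat) u v. (\<forall>i<n. a \<le> u i \<and> u i \<le> v i \<and> v i \<le> b) \<and>
        disjoint_family_on (\<lambda>i. {u i<..<v i}) {..<n} \<and> (\<Sum>i<n. v i - u i) < d
        \<longrightarrow> (\<Sum>i<n. norm (g (v i) - g (u i))) < e"
  proof (intro exI[of _ d] conjI d allI impI, elim conjE)
    fix n :: nat and u v :: "nat \<Rightarrow> real"
    assume uv: "\<forall>i<n. a \<le> u i \<and> u i \<le> v i \<and> v i \<le> b"
      and *: "disjoint_family_on (\<lambda>i. {u i<..<v i}) {..<n}" "(\<Sum>i<n. v i - u i) < d"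
    have "(\<Sum>i<n. norm (g (v i) - g (u i))) \<le> (\<Sum>i<n. (\<bar>K\<bar> + 1) * norm (f (v i) - f (u i)))"
    proof (rule sum_mono)
      fix i assume "i \<in> {..<n}"
      then have "norm (g (v i) - g (u i)) \<le> K * norm (f (v i) - f (u i))"
        using uv by (intro lip) force+
      also have "\<dots> \<le> (\<bar>K\<bar> + 1) * norm (f (v i) - f (u i))"
        by (intro mult_right_mono) auto
      finally show "norm (g (v i) - g (u i)) \<le> (\<bar>K\<bar> + 1) * norm (f (v i) - f (u i))" .
    qed
    also have "\<dots> = (\<bar>K\<bar> + 1) * (\<Sum>i<n. norm (f (v i) - f (u i)))"
      by (simp add: sum_distrib_left)
    also have "\<dots> < (\<bar>K\<bar> + 1) * (e / (\<bar>K\<bar> + 1))"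
      using D[of n u v] uv * by (intro mult_strict_left_mono) auto
    finally show "(\<Sum>i<n. norm (g (v i) - g (u i))) < e" by simp
  qed
qed

lemma absolutely_continuous_on_ivl_subset:
  assumes "absolutely_continuous_on_ivl a b f" and "a \<le> c" "d \<le> b"
  shows "absolutely_continuous_on_ivl c d f"
  unfolding absolutely_continuous_on_ivl_def
proof (intro allI impI)
  fix e :: real assume "e > 0"
  obtain k where k: "k > 0" and D: "\<And>(n::nat) u v. \<lbrakk>\<And>i. i < n \<Longrightarrow> a \<le> u i \<and> u i \<le> v i \<and> v i \<le> b;
        disjoint_family_on (\<lambda>i. {u i<..<v i}) {..<n}; (\<Sum>i<n. v i - u i) < k\<rbrakk>
        \<Longrightarrow> (\<Sum>i<n. norm (f (v i) - f (u i))) < e"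
    by (fact absolutely_continuous_on_ivlE[OF assms(1) \<open>e > 0\<close>])
  show "\<exists>k>0. \<forall>(n::nat) u v. (\<forall>i<n. c \<le> u i \<and> u i \<le> v i \<and> v i \<le> d) \<and>
        disjoint_family_on (\<lambda>i. {u i<..<v i}) {..<n} \<and> (\<Sum>i<n. v i - u i) < k
        \<longrightarrow> (\<Sum>i<n. norm (f (v i) - f (u i))) < e"
  proof (intro exI[of _ k] conjI k allI impI D; elim conjE)
    fix n i :: nat and u v :: "nat \<Rightarrow> real"
    assume "\<forall>i<n. c \<le> u i \<and> u i \<le> v i \<and> v i \<le> d" "i < n"
    then show "a \<le> u i" "u i \<le> v i" "v i \<le> b" using assms(2,3) by force+
  qed
qed

text \<open>
  Cousin's lemma: tags outside the null set control their intervals through the derivative, the other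
  intervals have small total length and are controlled by absolute continuity.
\<close>

lemma absolutely_continuous_deriv_le:
  fixes f :: "real \<Rightarrow> real"
  assumes ac: "absolutely_continuous_on_ivl a b f" and ab: "a \<le> b"
    and N: "negligible N"
    and der: "\<And>t. t \<in> {a..b} - N \<Longrightarrow> \<exists>D\<le>c. (f has_real_derivative D) (at t within {a..b})"
  shows "f b - f a \<le> c * (b - a)"
proof -
  \<comment> \<open>The three errors: \<open>e * (b - a)\<close> from the slack in the derivative,
    \<open>e * \<bar>c\<bar>\<close> from the length covered by intervals with tags in
    \<open>N\<close>, and \<open>e\<close> from the variation of \<open>f\<close> over those
    intervals.\<close>
  have main: "f b - f a \<le> c * (b - a) + e * ((b - a) + \<bar>c\<bar> + 1)" if e: "e > 0" for e
  proof -
    obtain k where k: "k > 0" and D: "\<And>(n::nat) u v. \<lbrakk>\<And>i. i < n \<Longrightarrow> a \<le> u i \<and> u i \<le> v i \<and> v i \<le> b;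
        disjoint_family_on (\<lambda>i. {u i<..<v i}) {..<n}; (\<Sum>i<n. v i - u i) < k\<rbrakk>
        \<Longrightarrow> (\<Sum>i<n. norm (f (v i) - f (u i))) < e"
    by (fact absolutely_continuous_on_ivlE[OF ac e])
    have Nn: "N \<in> null_sets lebesgue" using N by (simp add: negligible_iff_null_sets)
    then have "N \<in> sets lebesgue" by auto
    \<comment> \<open>Measure below \<open>k\<close> makes absolute continuity applicable to
      intervals inside \<open>U\<close>; measure below \<open>e\<close> bounds their total length in
      the final estimate.\<close>
    then obtain U where U: "open U" "N \<subseteq> U" "U - N \<in> lmeasurable"
        "emeasure lebesgue (U - N) < ennreal (min k e)"
      using sets_lebesgue_outer_open[of N "min k e"] k e by auto
    have UNN: "U = (U - N) \<union> N" using U(2) by blast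
    have Um: "U \<in> lmeasurable"
      using fmeasurable.Un[OF U(3) negligible_imp_measurable[OF N]] UNN by simp
    have "emeasure lebesgue U = emeasure lebesgue (U - N)"
      using Nn U(1) by (intro emeasure_Diff_null_set[symmetric]) auto
    then have "ennreal (measure lebesgue U) < ennreal (min k e)"
      using U(4) Um by (simp add: emeasure_eq_measure2)
    then have mU: "measure lebesgue U < min k e" by (simp add: ennreal_less_iff)
    \<comment> \<open>The gauge. Around points of \<open>N\<close> it keeps intervals inside
      \<open>U\<close>; at the other points of \<open>{a..b}\<close> it gives the straddle estimate,
      where \<open>u \<le> t \<le> v\<close> lets the two one-sided errors add up to exactly
      \<open>e * (v - u)\<close>.\<close>
    have "\<exists>d>0. (t \<in> N \<longrightarrow> ball t d \<subseteq> U) \<and>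
        (t \<in> {a..b} - N \<longrightarrow> (\<forall>u v. u \<in> {a..b} \<and> v \<in> {a..b} \<and> u \<in> ball t d \<and> v \<in> ball t d \<and> u \<le> t \<and> t \<le> v
           \<longrightarrow> f v - f u \<le> (c + e) * (v - u)))" for t
    proof -
      consider "t \<in> N" | "t \<in> {a..b} - N" | "t \<notin> N" "t \<notin> {a..b}" by blast
      then show ?thesis
      proof cases
        case 1
        then obtain d where "d > 0" "ball t d \<subseteq> U" using U(1,2) open_contains_ball by blast
        with 1 show ?thesis by blast
      next
        case 2
        then obtain D' where D': "D' \<le> c" "(f has_real_derivative D') (at t within {a..b})"
          using der by blast
        then obtain d where d: "d > 0"
          "\<And>y. y \<in> {a..b} \<Longrightarrow> norm (y - t) < d \<Longrightarrow> norm (f y - f t - D' * (y - t)) \<le> e * norm (y - t)"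
          using e unfolding has_field_derivative_def has_derivative_within_alt by metis
        have "f v - f u \<le> (c + e) * (v - u)"
          if "u \<in> {a..b}" "v \<in> {a..b}" "u \<in> ball t d" "v \<in> ball t d" "u \<le> t" "t \<le> v" for u v
        proof -
          have "f v - f t - D' * (v - t) \<le> e * (v - t)"
            using d(2)[of v] that by (auto simp: dist_real_def)
          moreover have "- (f u - f t - D' * (u - t)) \<le> e * (t - u)"
            using d(2)[of u] that by (auto simp: dist_real_def)
          ultimately have "f v - f u \<le> (D' + e) * (v - u)" by (simp add: algebra_simps)
          also have "\<dots> \<le> (c + e) * (v - u)"
            using D'(1) that by (intro mult_right_mono) auto
          finally show ?thesis .
        qed
        with 2 d(1) show ?thesis by blast
      next
        case 3
        then show ?thesis by (intro exI[of _ 1]) auto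
      qed
    qed
    then obtain d where d: "\<And>t. d t > 0" "\<And>t. t \<in> N \<Longrightarrow> ball t (d t) \<subseteq> U"
      "\<And>t u v. t \<in> {a..b} - N \<Longrightarrow> u \<in> {a..b} \<Longrightarrow> v \<in> {a..b} \<Longrightarrow> u \<in> ball t (d t) \<Longrightarrow> v \<in> ball t (d t)
           \<Longrightarrow> u \<le> t \<Longrightarrow> t \<le> v \<Longrightarrow> f v - f u \<le> (c + e) * (v - u)"
      by metis
    have "gauge (\<lambda>t. ball t (d t))" using d(1) by (simp add: gauge_def)
    then obtain p where p: "p tagged_division_of {a..b}" "(\<lambda>t. ball t (d t)) fine p"
      using fine_division_exists_real by blast
    note pD = tagged_division_ofD[OF p(1)]
    have K: "K = {Inf K..Sup K} \<and> Inf K \<le> t \<and> t \<le> Sup K \<and> a \<le> Inf K \<and> Sup K \<le> b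
        \<and> {Inf K..Sup K} \<subseteq> ball t (d t) \<and> measure lebesgue K = Sup K - Inf K"
      if tKp: "(t, K) \<in> p" for t K
    proof -
      obtain u v where uv: "K = {u..v}" using pD(4)[OF tKp] by auto
      have tK: "t \<in> K" using pD(2)[OF that] .
      then have le: "u \<le> v" using uv by auto
      have "K \<subseteq> {a..b}" using pD(3)[OF that] .
      moreover have "K \<subseteq> ball t (d t)" using p(2) that by (auto simp: fine_def)
      ultimately show ?thesis using uv tK le by simp
    qed
    define p1 where "p1 = {z \<in> p. fst z \<in> N}"
    define p2 where "p2 = {z \<in> p. fst z \<notin> N}"
    have fin: "finite p1" "finite p2" "finite p" using pD(1) by (auto simp: p1_def p2_def)
    have split: "sum w p = sum w p1 + sum w p2" for w :: "real \<times> real set \<Rightarrow> real"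
      using fin by (subst sum.union_disjoint[symmetric]) (auto simp: p1_def p2_def intro!: sum.cong)
    let ?F = "\<lambda>z. f (Sup (snd z)) - f (Inf (snd z))"
    let ?L = "\<lambda>z. Sup (snd z) - Inf (snd z) :: real"
    have totF: "sum ?F p = f b - f a"
      using additive_tagged_division_1[OF ab p(1), of f] by (simp add: case_prod_unfold)
    have totL: "sum ?L p = b - a"
      using additive_tagged_division_1[OF ab p(1), of "\<lambda>x. x"] by (simp add: case_prod_unfold)
    have p2: "sum ?F p2 \<le> (c + e) * sum ?L p2"
      unfolding sum_distrib_left
    proof (rule sum_mono)
      fix z assume z: "z \<in> p2"
      obtain t J where tJ: "z = (t, J)" by (cases z)
      then have "(t, J) \<in> p" "t \<notin> N" using z by (auto simp: p2_def)
      then show "?F z \<le> (c + e) * ?L z"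
        using K[of t J] d(3)[of t "Inf J" "Sup J"] unfolding tJ by force
    qed
    \<comment> \<open>Absolute continuity speaks of families indexed by an initial segment of the
      naturals, so the intervals with tags in \<open>N\<close> are enumerated.\<close>
    obtain g :: "nat \<Rightarrow> _" where g: "bij_betw g {..<card p1} p1"
      using ex_bij_betw_nat_finite[OF fin(1)] by (auto simp: atLeast0LessThan)
    define u where "u i = Inf (snd (g i))" for i
    define v where "v i = Sup (snd (g i))" for i
    have gp: "(fst (g i), snd (g i)) \<in> p" "fst (g i) \<in> N" if "i < card p1" for i
      using bij_betwE[OF g] that by (auto simp: p1_def)
    have uv: "\<forall>i<card p1. a \<le> u i \<and> u i \<le> v i \<and> v i \<le> b"
      using K[OF gp(1)] by (force simp: u_def v_def)
    have disj: "disjoint_family_on (\<lambda>i. {u i<..<v i}) {..<card p1}"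
      unfolding disjoint_family_on_def
    proof (intro ballI impI)
      fix i j assume ij: "i \<in> {..<card p1}" "j \<in> {..<card p1}" "i \<noteq> j"
      then have "g i \<noteq> g j" using g by (auto simp: bij_betw_def inj_on_def)
      then have "interior (snd (g i)) \<inter> interior (snd (g j)) = {}"
        using pD(5)[OF gp(1) gp(1)] ij by (simp add: prod_eq_iff)
      moreover have "interior (snd (g i)) = {u i<..<v i}" if "i < card p1" for i
        using K[OF gp(1)[OF that]] unfolding u_def v_def by (metis interior_atLeastAtMost_real)
      ultimately show "{u i<..<v i} \<inter> {u j<..<v j} = {}" using ij by auto
    qed
    have "(\<Sum>i<card p1. v i - u i) = (\<Sum>i<card p1. measure lebesgue {u i<..<v i})"
      using uv by (intro sum.cong) auto
    also have "\<dots> = measure lebesgue (\<Union>i<card p1. {u i<..<v i})"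
      using disj by (intro measure_UNION'[symmetric])
        (auto simp: pairwise_def disjoint_family_on_def disjnt_def simp del: greaterThanLessThan_iff)
    also have "\<dots> \<le> measure lebesgue U"
    proof (rule measure_mono_fmeasurable[OF _ _ Um])
      show "(\<Union>i<card p1. {u i<..<v i}) \<subseteq> U"
      proof (rule UN_least)
        fix i assume "i \<in> {..<card p1}"
        then have i: "i < card p1" by simp
        have "{u i<..<v i} \<subseteq> {u i..v i}" by auto
        also have "\<dots> \<subseteq> ball (fst (g i)) (d (fst (g i)))"
          using K[OF gp(1)[OF i]] unfolding u_def v_def by blast
        also have "\<dots> \<subseteq> U" using d(2) gp(2)[OF i] .
        finally show "{u i<..<v i} \<subseteq> U" .
      qed
    qed auto
    finally have L1: "(\<Sum>i<card p1. v i - u i) < min k e" using mU by linarith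
    have reL: "sum ?L p1 = (\<Sum>i<card p1. v i - u i)"
      unfolding u_def v_def by (rule sum.reindex_bij_betw[OF g, symmetric])
    have "sum ?F p1 = (\<Sum>i<card p1. f (v i) - f (u i))"
      unfolding u_def v_def by (rule sum.reindex_bij_betw[OF g, symmetric])
    also have "\<dots> \<le> (\<Sum>i<card p1. norm (f (v i) - f (u i)))"
      by (rule sum_mono) auto
    also have "\<dots> < e" using D[of "card p1" u v] uv disj L1 by simp
    finally have F1: "sum ?F p1 < e" .
    have L0: "0 \<le> sum ?L p1" unfolding reL using uv by (intro sum_nonneg) auto
    have L2: "sum ?L p1 \<le> e" using L1 reL by simp
    have "sum ?L p2 = (b - a) - sum ?L p1" using totL split[of ?L] by simp
    then have "sum ?F p2 \<le> (c + e) * ((b - a) - sum ?L p1)" using p2 by simp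
    \<comment> \<open>The sign of \<open>c\<close> is arbitrary: for negative \<open>c\<close> the
      length missing from \<open>p2\<close> weakens the bound, but by no more than this.\<close>
    moreover have "- c * sum ?L p1 \<le> \<bar>c\<bar> * e"
      using L0 L2 by (meson abs_ge_minus_self abs_ge_zero mult_mono' mult_right_mono mult_left_mono order_trans)
    moreover have "0 \<le> e * sum ?L p1" using e L0 by simp
    ultimately show ?thesis using totF split[of ?F] F1 by (simp add: algebra_simps)
  qed
  show ?thesis
  proof (rule field_le_epsilon)
    fix \<eta> :: real assume "\<eta> > 0"
    then show "f b - f a \<le> c * (b - a) + \<eta>"
      using main[of "\<eta> / ((b - a) + \<bar>c\<bar> + 1)"] ab by (simp add: add_nonneg_pos)
  qed
qed

lemma absolutely_continuous_on_ivl_imp_continuous_on: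
  assumes "absolutely_continuous_on_ivl a b f"
  shows "continuous_on {a..b} f"
  unfolding continuous_on_iff
proof (intro ballI allI impI)
  fix t e :: real assume t: "t \<in> {a..b}" and e: "e > 0"
  obtain d where d: "d > 0"
    and D: "\<And>(n::nat) u v. \<lbrakk>\<And>i. i < n \<Longrightarrow> a \<le> u i \<and> u i \<le> v i \<and> v i \<le> b;
        disjoint_family_on (\<lambda>i. {u i<..<v i}) {..<n}; (\<Sum>i<n. v i - u i) < d\<rbrakk>
        \<Longrightarrow> (\<Sum>i<n. norm (f (v i) - f (u i))) < e"
    by (fact absolutely_continuous_on_ivlE[OF assms e])
  have *: "norm (f v - f u) < e" if "a \<le> u" "u \<le> v" "v \<le> b" "v - u < d" for u v
    using D[of 1 "\<lambda>_. u" "\<lambda>_. v"] that by (simp add: disjoint_family_on_def)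
  show "\<exists>d>0. \<forall>s\<in>{a..b}. dist s t < d \<longrightarrow> dist (f s) (f t) < e"
  proof (intro exI[of _ d] conjI d ballI impI)
    fix s assume "s \<in> {a..b}" "dist s t < d"
    then show "dist (f s) (f t) < e"
      using *[of s t] *[of t s] t by (cases "s \<le> t") (auto simp: dist_real_def dist_norm norm_minus_commute)
  qed
qed

text \<open>Reduces to the scalar estimate by taking the inner product with the increment
  \<open>f b - f a\<close> itself. It will turn the bound on the velocity into a Lipschitz bound in
  time.\<close>

lemma absolutely_continuous_deriv_norm_le:
  fixes f :: "real \<Rightarrow> 'a::real_inner"
  assumes ac: "absolutely_continuous_on_ivl a b f" and ab: "a \<le> b"
    and N: "negligible N"
    and der: "\<And>t. t \<in> {a..b} - N \<Longrightarrow> \<exists>f'. norm f' \<le> M \<and> (f has_vector_derivative f') (at t within {a..b})"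
  shows "norm (f b - f a) \<le> M * (b - a)"
proof -
  define e where "e = f b - f a"
  have "f b \<bullet> e - f a \<bullet> e \<le> (M * norm e) * (b - a)"
  proof (rule absolutely_continuous_deriv_le[OF _ ab N])
    show "absolutely_continuous_on_ivl a b (\<lambda>t. f t \<bullet> e)"
    proof (rule absolutely_continuous_on_ivl_dominated[OF ac])
      show "norm (f t \<bullet> e - f s \<bullet> e) \<le> norm e * norm (f t - f s)" for s t
        using Cauchy_Schwarz_ineq2[of "f t - f s" e] by (simp add: inner_diff_left mult.commute)
    qed
    fix t assume "t \<in> {a..b} - N"
    then obtain f' where f': "norm f' \<le> M" "(f has_vector_derivative f') (at t within {a..b})"
      using der by blast
    have "((\<lambda>t. f t \<bullet> e) has_vector_derivative f' \<bullet> e) (at t within {a..b})"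
      by (rule bounded_linear.has_vector_derivative[OF bounded_linear_inner_left f'(2)])
    moreover have "f' \<bullet> e \<le> M * norm e"
      using norm_cauchy_schwarz[of f' e] f'(1) by (meson mult_right_mono norm_ge_zero order_trans)
    ultimately show "\<exists>D\<le>M * norm e. ((\<lambda>t. f t \<bullet> e) has_real_derivative D) (at t within {a..b})"
      by (auto simp: has_real_derivative_iff_has_vector_derivative)
  qed
  then have "norm e * norm e \<le> (M * (b - a)) * norm e"
    unfolding inner_diff_left[symmetric] e_def[symmetric] by (simp add: norm_eq_sqrt_inner algebra_simps)
  then show ?thesis
    unfolding e_def[symmetric]
  proof (cases "norm e = 0")
    case True
    \<comment> \<open>Nothing can be cancelled here, so \<open>M * (b - a)\<close> must be seen to
      be nonnegative: either some derivative outside \<open>N\<close> is bounded by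
      \<open>M\<close>, or the interval is negligible and \<open>a = b\<close>.\<close>
    show "norm e \<le> M * (b - a)"
    proof (cases "{a..b} - N = {}")
      case False
      then obtain t where "t \<in> {a..b} - N" by blast
      then obtain f' :: 'a where "norm f' \<le> M" using der by blast
      then have "0 \<le> M" using norm_ge_zero order_trans by blast
      then show ?thesis using ab True by simp
    next
      case True
      then have "negligible {a..b}" using N negligible_subset by (metis Diff_eq_empty_iff)
      then have "a = b" using ab by (auto simp: negligible_iff_measure)
      then show ?thesis by (simp add: e_def)
    qed
  qed (simp add: mult_le_cancel_right)
qed

section \<open>Nested convex sets and weak convergence\<close>

text \<open>Points of almost minimal norm form a Cauchy sequence by the parallelogram law.\<close>

lemma nested_convex_Inter_nonempty:
  fixes K :: "nat \<Rightarrow> 'a::{real_inner, complete_space} set"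
  assumes cl: "\<And>n. closed (K n)" and cv: "\<And>n. convex (K n)" and ne: "\<And>n. K n \<noteq> {}"
    and dec: "decseq K" and bd: "bounded (K 0)"
  shows "(\<Inter>n. K n) \<noteq> {}"
proof -
  define d where "d n = (INF v\<in>K n. (norm v)\<^sup>2)" for n
  obtain B where B: "\<And>v. v \<in> K 0 \<Longrightarrow> norm v \<le> B"
    using bd by (auto simp: bounded_iff)
  have sub: "K n \<subseteq> K m" if "m \<le> n" for m n
    using dec that by (simp add: decseq_def)
  have bb: "bdd_below ((\<lambda>v. (norm v)\<^sup>2) ` K n)" for n
    by (rule bdd_belowI[of _ 0]) auto
  have d_le: "d n \<le> (norm v)\<^sup>2" if "v \<in> K n" for v n
    unfolding d_def using bb that by (rule cINF_lower)
  have inc: "incseq d"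
    unfolding incseq_def d_def by (auto intro!: cINF_superset_mono ne bb sub)
  have dB: "d n \<le> B\<^sup>2" for n
  proof -
    obtain v where v: "v \<in> K n" using ne by blast
    then have "norm v \<le> B" using B sub[of 0 n] by auto
    then have "(norm v)\<^sup>2 \<le> B\<^sup>2" by (simp add: power_mono)
    with d_le[OF v] show ?thesis by linarith
  qed
  have "convergent d"
    using incseq_convergent[OF inc, of "B\<^sup>2"] dB by (metis convergentI)
  then obtain L where L: "d \<longlonglongrightarrow> L" by (auto simp: convergent_def)
  have dL: "d n \<le> L" for n using incseq_le[OF inc L] .
  have "\<exists>v\<in>K n. (norm v)\<^sup>2 < d n + 1 / real (Suc n)" for n
  proof -
    have "d n < d n + 1 / real (Suc n)" by simp
    then show ?thesis unfolding d_def by (subst (asm) (1) cINF_less_iff[OF ne bb]) 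
  qed
  then obtain p where p: "\<And>n. p n \<in> K n" "\<And>n. (norm (p n))\<^sup>2 < d n + 1 / real (Suc n)"
    by metis
  \<comment> \<open>The midpoint of \<open>p m\<close> and \<open>p n\<close> lies in
    \<open>K m\<close>, so its squared norm is at least \<open>d m\<close>; the parallelogram law
    leaves \<open>2 * (L - d m) + 4 / real (Suc m)\<close>, which \<open>d m \<le> L\<close> lets
    one enlarge to the stated bound.\<close>
  have key: "(norm (p m - p n))\<^sup>2 \<le> 4 * (L - d m + 1 / real (Suc m))" if "m \<le> n" for m n
  proof -
    have "p n \<in> K m" using p(1) sub[OF that] by blast
    then have "(1/2) *\<^sub>R p m + (1/2) *\<^sub>R p n \<in> K m"
      using cv p(1) by (intro convexD) auto
    then have "d m \<le> (norm ((1/2) *\<^sub>R p m + (1/2) *\<^sub>R p n))\<^sup>2" by (rule d_le)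
    also have "\<dots> = (norm (p m + p n))\<^sup>2 / 4"
      by (simp add: power_mult_distrib power2_norm_eq_inner algebra_simps inner_commute)
    finally have 1: "4 * d m \<le> (norm (p m + p n))\<^sup>2" by simp
    have 2: "(norm (p m - p n))\<^sup>2 + (norm (p m + p n))\<^sup>2 = 2 * (norm (p m))\<^sup>2 + 2 * (norm (p n))\<^sup>2"
      by (simp add: power2_norm_eq_inner algebra_simps)
    have "1 / real (Suc n) \<le> 1 / real (Suc m)" using that by (simp add: frac_le)
    then have "(norm (p n))\<^sup>2 \<le> L + 1 / real (Suc m)"
      using p(2)[of n] dL[of n] by linarith
    then show ?thesis using 1 2 p(2)[of m] dL[of m] by argo
  qed
  have lim0: "(\<lambda>m. 4 * (L - d m + 1 / real (Suc m))) \<longlonglongrightarrow> 4 * (L - L + 0)"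
    by (intro tendsto_intros L LIMSEQ_Suc[OF lim_1_over_n])
  have "Cauchy p"
  proof (rule CauchyI')
    fix e :: real assume e: "e > 0"
    have "\<forall>\<^sub>F m in sequentially. 4 * (L - d m + 1 / real (Suc m)) < e\<^sup>2"
      using order_tendstoD(2)[OF lim0, of "e\<^sup>2"] e by simp
    then obtain M where M: "\<And>m. m \<ge> M \<Longrightarrow> 4 * (L - d m + 1 / real (Suc m)) < e\<^sup>2"
      by (auto simp: eventually_sequentially)
    show "\<exists>M. \<forall>m\<ge>M. \<forall>n>m. dist (p m) (p n) < e"
    proof (intro exI allI impI)
      fix m n assume "M \<le> m" "m < n"
      then have "(norm (p m - p n))\<^sup>2 < e\<^sup>2"
        using key[of m n] M[of m] by linarith
      then show "dist (p m) (p n) < e"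
        unfolding dist_norm using e by (simp add: power2_less_imp_less)
    qed
  qed
  then obtain l where l: "p \<longlonglongrightarrow> l" using Cauchy_convergent by (auto simp: convergent_def)
  have "l \<in> K n" for n
  proof (rule Lim_in_closed_set[OF cl _ _ l])
    show "\<forall>\<^sub>F m in sequentially. p m \<in> K n"
      using eventually_ge_at_top[of n] by eventually_elim (use p(1) sub in blast)
  qed simp
  then show ?thesis by blast
qed

text \<open>A continuous-time form of Opial's lemma, in which the points common to the closed convex
  hulls of all tails take the place of weak cluster points.\<close>

lemma weakly_converges_if_dist_converges:
  fixes X :: "real \<Rightarrow> 'a::{real_inner, complete_space}"
  assumes bd: "bounded (X ` {0..})"
    and conv: "\<And>z. z \<in> S \<Longrightarrow> \<exists>l. ((\<lambda>t. norm (X t - z)) \<longlongrightarrow> l) at_top"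
    and hull: "\<And>p. (\<And>n::nat. p \<in> closure (convex hull (X ` {real n..}))) \<Longrightarrow> p \<in> S"
  shows "\<exists>z\<in>S. weakly_converges X z at_top"
proof -
  \<comment> \<open>The set \<open>A\<close> selects times: \<open>UNIV\<close> gives the full
    tails, and later \<open>A\<close> consists of the times at which a functional stays away from
    its expected limit.\<close>
  define K where "K A n = closure (convex hull (X ` ({real n..} \<inter> A)))" for A and n :: nat
  have K_sub: "K A n \<subseteq> B" if "closed B" "convex B" "\<And>t. t \<in> A \<Longrightarrow> real n \<le> t \<Longrightarrow> X t \<in> B" for A n B
    unfolding K_def using that by (intro closure_minimal hull_minimal) auto
  have K_mono: "K A n \<subseteq> K A' n'" if "A \<subseteq> A'" "n' \<le> n" for A A' n n'
    unfolding K_def using that by (intro closure_mono hull_mono image_mono) auto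
  have K_ne: "(\<Inter>n. K A n) \<noteq> {}" if A: "\<And>n::nat. \<exists>t\<ge>real n. t \<in> A" for A
  proof (rule nested_convex_Inter_nonempty)
    show "K A n \<noteq> {}" for n using A[of n] by (auto simp: K_def)
    show "bounded (K A 0)"
      unfolding K_def using bd by (intro bounded_closure bounded_convex_hull) (auto elim: bounded_subset)
  qed (auto simp: K_def decseq_def intro!: closure_mono hull_mono)
  have inS: "p \<in> S" if "\<And>n. p \<in> K UNIV n" for p
    using hull that by (simp add: K_def)
  have uniq: "p = q" if p: "\<And>n. p \<in> K UNIV n" and q: "\<And>n. q \<in> K UNIV n" for p q
  proof -
    obtain l1 where l1: "((\<lambda>t. norm (X t - p)) \<longlongrightarrow> l1) at_top" using conv[OF inS[OF p]] by blast
    obtain l2 where l2: "((\<lambda>t. norm (X t - q)) \<longlongrightarrow> l2) at_top" using conv[OF inS[OF q]] by blast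
    define l where "l = (l2\<^sup>2 - l1\<^sup>2 + (norm p)\<^sup>2 - (norm q)\<^sup>2) / 2"
    \<comment> \<open>In the difference of the squared distances the quadratic term in
      \<open>X t\<close> cancels. Hence the inner product with \<open>p - q\<close> converges to
      \<open>l\<close>; thin slabs around \<open>l\<close> contain tails, so also their closed
      hulls, and \<open>p\<close> and \<open>q\<close> have the same inner product with
      \<open>p - q\<close>.\<close>
    have eq: "X t \<bullet> (p - q) = ((norm (X t - q))\<^sup>2 - (norm (X t - p))\<^sup>2 + (norm p)\<^sup>2 - (norm q)\<^sup>2) / 2" for t
      unfolding power2_norm_eq_inner by (simp add: algebra_simps inner_commute)
    have lim: "((\<lambda>t. X t \<bullet> (p - q)) \<longlongrightarrow> l) at_top"
      unfolding eq l_def by (intro tendsto_intros l1 l2) auto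
    have "norm (p - q) * norm (p - q) \<le> 0 + e" if e: "e > 0" for e
    proof -
      have "\<forall>\<^sub>F t in at_top. dist (X t \<bullet> (p - q)) l < e / 2"
        using lim e by (intro tendstoD) auto
      then obtain s where s: "\<And>t. t \<ge> s \<Longrightarrow> dist (X t \<bullet> (p - q)) l < e / 2"
        by (auto simp: eventually_at_top_linorder)
      obtain n :: nat where n: "s \<le> real n" using real_arch_simple by blast
      have "K UNIV n \<subseteq> {w. (p - q) \<bullet> w \<le> l + e / 2} \<inter> {w. (p - q) \<bullet> w \<ge> l - e / 2}"
      proof (rule K_sub)
        fix t assume "real n \<le> t"
        then have "\<bar>X t \<bullet> (p - q) - l\<bar> < e / 2"
          using s[of t] n unfolding dist_real_def by linarith
        then have "X t \<bullet> (p - q) \<le> l + e / 2" "l - e / 2 \<le> X t \<bullet> (p - q)" by linarith+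
        then show "X t \<in> {w. (p - q) \<bullet> w \<le> l + e / 2} \<inter> {w. (p - q) \<bullet> w \<ge> l - e / 2}"
          by (simp add: inner_commute)
      qed (auto intro!: closed_Int convex_Int closed_halfspace_le closed_halfspace_ge
            convex_halfspace_le convex_halfspace_ge)
      with p[of n] q[of n] have "(p - q) \<bullet> p \<le> l + e / 2" "(p - q) \<bullet> q \<ge> l - e / 2" by auto
      then have "(p - q) \<bullet> (p - q) \<le> e" by (simp add: inner_diff_right)
      then show ?thesis by (simp add: norm_eq_sqrt_inner)
    qed
    then have "norm (p - q) * norm (p - q) \<le> 0" by (rule field_le_epsilon)
    then show ?thesis by (simp add: mult_le_0_iff)
  qed
  have "\<exists>t\<ge>real n. t \<in> UNIV" for n by auto
  then obtain z where z: "\<And>n. z \<in> K UNIV n" using K_ne[of UNIV] by auto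
  have upper: "\<forall>\<^sub>F t in at_top. f (X t) < f z + e" if f: "bounded_linear f" and e: "e > 0" for f :: "'a \<Rightarrow> real" and e
  proof (rule ccontr)
    assume not: "\<not> ?thesis"
    define A where "A = {t. f (X t) \<ge> f z + e}"
    have "\<exists>t\<ge>real n. t \<in> A" for n :: nat
      using not by (auto simp: A_def eventually_at_top_linorder not_less)
    then obtain p where p: "\<And>n. p \<in> K A n" using K_ne[of A] by auto
    then have "p \<in> K UNIV n" for n using K_mono[of A UNIV n n] by auto
    then have "p = z" using uniq z by blast
    moreover have "K A 0 \<subseteq> {w. f z + e \<le> f w}"
    proof (rule K_sub)
      show "closed {w. f z + e \<le> f w}"
        by (intro closed_Collect_le continuous_intros linear_continuous_on f)
      have "convex (f -` {f z + e..})"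
        using f by (intro convex_linear_vimage convex_real_interval) (simp add: bounded_linear.linear)
      then show "convex {w. f z + e \<le> f w}" by (simp add: vimage_def)
    qed (auto simp: A_def)
    ultimately have "f z + e \<le> f z" using p[of 0] by auto
    then show False using e by simp
  qed
  have "weakly_converges X z at_top"
    unfolding weakly_converges_def
  proof (intro allI impI order_tendstoI)
    fix f :: "'a \<Rightarrow> real" and c assume f: "bounded_linear f"
    show "\<forall>\<^sub>F t in at_top. f (X t) < c" if "f z < c"
      using upper[OF f, of "c - f z"] that by simp
    \<comment> \<open>The lower bound is the upper bound for the functional
      \<open>- f\<close>.\<close>
    show "\<forall>\<^sub>F t in at_top. c < f (X t)" if "c < f z"
      using upper[OF bounded_linear_minus[OF f], of "f z - c"] that by simp
  qed
  then show ?thesis using inS z by blast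
qed

section \<open>Proximal points and Minty's argument\<close>

text \<open>Serves twice after an inequality along a segment has been divided by the step
  \<open>s\<close>: for the proximal inequality and for Minty's argument.\<close>

lemma nonneg_if_right_limit_nonneg:
  fixes f :: "real \<Rightarrow> real"
  assumes "(f \<longlongrightarrow> l) (at_right 0)" and "\<And>s. 0 < s \<Longrightarrow> s \<le> 1 \<Longrightarrow> 0 \<le> f s"
  shows "0 \<le> l"
proof (rule tendsto_lowerbound[OF assms(1)])
  show "\<forall>\<^sub>F s in at_right 0. 0 \<le> f s"
    using assms(2) by (auto simp: eventually_at_right_field intro!: exI[of _ 1])
qed simp

text \<open>First-order optimality: compare \<open>p\<close> with the points of the segment towards
  \<open>w\<close>, use convexity of \<open>g\<close>, divide by \<open>s\<close> and let
  \<open>s\<close> tend to zero.\<close>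

lemma proximal_variational_inequality:
  fixes g :: "'a::real_inner \<Rightarrow> real"
  assumes g: "convex_on D g" and p: "p \<in> D"
    and min: "\<And>v. v \<in> D \<Longrightarrow> lam * g p + (norm (u - p))\<^sup>2 / 2 \<le> lam * g v + (norm (u - v))\<^sup>2 / 2"
    and lam: "lam > 0" and w: "w \<in> D"
  shows "(u - p) \<bullet> (w - p) \<le> lam * (g w - g p)"
proof -
  \<comment> \<open>The vanishing last term is kept so that the bound is literally the limit, with
    \<open>0\<close> substituted for \<open>s\<close>.\<close>
  have "0 \<le> lam * (g w - g p) - (u - p) \<bullet> (w - p) + 0 * (norm (w - p))\<^sup>2 / 2"
  proof (rule nonneg_if_right_limit_nonneg)
    show "((\<lambda>s. lam * (g w - g p) - (u - p) \<bullet> (w - p) + s * (norm (w - p))\<^sup>2 / 2) \<longlongrightarrow>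
        lam * (g w - g p) - (u - p) \<bullet> (w - p) + 0 * (norm (w - p))\<^sup>2 / 2) (at_right 0)"
      by (intro tendsto_intros) auto
    fix s :: real assume s: "0 < s" "s \<le> 1"
    define v where "v = (1 - s) *\<^sub>R p + s *\<^sub>R w"
    have "v \<in> D" unfolding v_def using convex_on_imp_convex[OF g] p w s by (intro convexD) auto
    then have 1: "lam * g p + (norm (u - p))\<^sup>2 / 2 \<le> lam * g v + (norm (u - v))\<^sup>2 / 2" by (rule min)
    have "g v \<le> (1 - s) * g p + s * g w"
      unfolding v_def using s p w by (intro convex_onD[OF g]) auto
    then have 2: "lam * g v \<le> lam * ((1 - s) * g p + s * g w)" using lam by simp
    have uv: "u - v = (u - p) - s *\<^sub>R (w - p)" by (simp add: v_def algebra_simps)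
    have "(norm (a - s *\<^sub>R c))\<^sup>2 = (norm a)\<^sup>2 - 2 * s * (a \<bullet> c) + s\<^sup>2 * (norm c)\<^sup>2" for a c :: 'a
      unfolding power2_norm_eq_inner by (simp add: inner_diff_left inner_diff_right inner_commute power2_eq_square)
    then have 3: "(norm (u - v))\<^sup>2 = (norm (u - p))\<^sup>2 - 2 * s * ((u - p) \<bullet> (w - p)) + s\<^sup>2 * (norm (w - p))\<^sup>2"
      unfolding uv .
    define q where "q = (u - p) \<bullet> (w - p)"
    have "0 \<le> s * (lam * (g w - g p) - q + s * (norm (w - p))\<^sup>2 / 2)"
      using 1 2 unfolding 3 q_def[symmetric]
      by (simp add: algebra_simps power2_eq_square add_divide_distrib diff_divide_distrib)
    then show "0 \<le> lam * (g w - g p) - (u - p) \<bullet> (w - p) + s * (norm (w - p))\<^sup>2 / 2"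
      using s unfolding q_def by (simp add: zero_le_mult_iff)
  qed
  then show ?thesis by simp
qed

lemma convex_sublevel:
  fixes f :: "'a::real_vector \<Rightarrow> real"
  assumes f: "convex_on D f"
  shows "convex {v \<in> D. f v \<le> c}"
proof (rule convexI)
  fix v w and a b :: real
  assume *: "v \<in> {v \<in> D. f v \<le> c}" "w \<in> {v \<in> D. f v \<le> c}" "0 \<le> a" "0 \<le> b" "a + b = 1"
  then have "f (a *\<^sub>R v + b *\<^sub>R w) \<le> a * f v + b * f w" using f by (simp add: convex_on_def)
  also have "\<dots> \<le> c" using * by (intro convex_bound_le) auto
  finally show "a *\<^sub>R v + b *\<^sub>R w \<in> {v \<in> D. f v \<le> c}"
    using * convexD[OF convex_on_imp_convex[OF f]] by simp
qed

text \<open>The sets of almost minimisers are closed, convex, decreasing and bounded, so they have a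
  common point. Closedness is assumed for comparison with any continuous \<open>c\<close>, because
  the quadratic term of the objective moves to the right-hand side. The affine minorant yields
  coercivity.\<close>

lemma proximal_point_exists:
  fixes g :: "'a::{real_inner, complete_space} \<Rightarrow> real"
  assumes g: "convex_on D g" and ne: "D \<noteq> {}"
    and cl: "\<And>c. continuous_on UNIV c \<Longrightarrow> closed {v \<in> D. g v \<le> c v}"
    and minorant: "\<And>v. v \<in> D \<Longrightarrow> b + a \<bullet> v \<le> g v"
    and lam: "lam > 0"
  shows "\<exists>p\<in>D. \<forall>v\<in>D. lam * g p + (norm (u - p))\<^sup>2 / 2 \<le> lam * g v + (norm (u - v))\<^sup>2 / 2"
proof -
  define \<phi> where "\<phi> v = lam * g v + (norm (u - v))\<^sup>2 / 2" for v
  \<comment> \<open>Completing the square absorbs the linear part of the minorant into half of the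
    quadratic term; this constant and a quarter of the squared distance remain.\<close>
  define M where "M = lam * b + lam * (a \<bullet> u) - lam\<^sup>2 * (norm a)\<^sup>2"
  have \<phi>_ge: "M + (norm (u - v))\<^sup>2 / 4 \<le> \<phi> v" if "v \<in> D" for v
  proof -
    have "lam * (b + a \<bullet> v) \<le> lam * g v" using minorant[OF that] lam by simp
    moreover have "lam * (b + a \<bullet> v) = lam * b + lam * (a \<bullet> u) - lam * (a \<bullet> (u - v))"
      by (simp add: inner_diff_right algebra_simps)
    moreover have "lam * (a \<bullet> (u - v)) \<le> lam * (norm a * norm (u - v))"
      using norm_cauchy_schwarz lam by simp
    moreover have "0 \<le> (norm (u - v) / 2 - lam * norm a)\<^sup>2" by simp
    moreover have "(norm (u - v) / 2 - lam * norm a)\<^sup>2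
        = (norm (u - v))\<^sup>2 / 4 - lam * (norm a * norm (u - v)) + lam\<^sup>2 * (norm a)\<^sup>2"
      by (simp add: power2_diff power_mult_distrib power_divide)
    ultimately show ?thesis unfolding \<phi>_def M_def by linarith
  qed
  have bb: "bdd_below (\<phi> ` D)"
  proof (rule bdd_belowI2[of _ M])
    show "M \<le> \<phi> v" if "v \<in> D" for v
      using \<phi>_ge[OF that] zero_le_power2[of "norm (u - v)"] by linarith
  qed
  define m where "m = (INF v\<in>D. \<phi> v)"
  have m_le: "m \<le> \<phi> v" if "v \<in> D" for v unfolding m_def using bb that by (rule cINF_lower)
  have "convex_on D \<phi>"
  proof -
    have "convex_on D (\<lambda>v. (norm (u - v))\<^sup>2 / 2)"
    proof (rule convex_onI)
      fix s v w assume s: "0 < (s::real)" "s < 1"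
      have "(1 - s) * (norm (u - v))\<^sup>2 + s * (norm (u - w))\<^sup>2
          - (norm (u - ((1 - s) *\<^sub>R v + s *\<^sub>R w)))\<^sup>2 = s * (1 - s) * (norm (v - w))\<^sup>2"
        unfolding power2_norm_eq_inner by (simp add: inner_add_left inner_add_right inner_diff_left inner_diff_right
            inner_commute algebra_simps)
      moreover have "0 \<le> s * (1 - s) * (norm (v - w))\<^sup>2" using s by simp
      ultimately show "(norm (u - ((1 - s) *\<^sub>R v + s *\<^sub>R w)))\<^sup>2 / 2
          \<le> (1 - s) * ((norm (u - v))\<^sup>2 / 2) + s * ((norm (u - w))\<^sup>2 / 2)"
        by (simp add: field_simps)
    qed (rule convex_on_imp_convex[OF g])
    then show ?thesis unfolding \<phi>_def using lam by (intro convex_on_add convex_on_cmul g) auto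
  qed
  define K where "K n = {v \<in> D. \<phi> v \<le> m + 1 / real (Suc n)}" for n
  have "(\<Inter>n. K n) \<noteq> {}"
  proof (rule nested_convex_Inter_nonempty)
    fix n
    have "K n = {v \<in> D. g v \<le> (m + 1 / real (Suc n) - (norm (u - v))\<^sup>2 / 2) / lam}"
      unfolding K_def \<phi>_def pos_le_divide_eq[OF lam] le_diff_eq mult.commute[of _ lam] ..
    then show "closed (K n)" by (simp only:) (intro cl continuous_intros, use lam in auto)
    show "convex (K n)"
      unfolding K_def by (rule convex_sublevel[OF \<open>convex_on D \<phi>\<close>])
    have "m < m + 1 / real (Suc n)" by simp
    then have "\<exists>v\<in>D. \<phi> v < m + 1 / real (Suc n)"
      using cINF_less_iff[OF ne bb, of "m + 1 / real (Suc n)"] unfolding m_def by blast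
    then show "K n \<noteq> {}" by (auto simp: K_def intro: less_imp_le)
  next
    show "decseq K"
      unfolding decseq_Suc_iff K_def
    proof (intro allI subsetI, clarify)
      fix n v assume "\<phi> v \<le> m + 1 / real (Suc (Suc n))"
      moreover have "1 / real (Suc (Suc n)) \<le> 1 / real (Suc n)" by (simp add: frac_le)
      ultimately show "\<phi> v \<le> m + 1 / real (Suc n)" by linarith
    qed
    show "bounded (K 0)"
    proof (rule boundedI)
      fix v assume "v \<in> K 0"
      then have "v \<in> D" "\<phi> v \<le> m + 1" by (auto simp: K_def)
      then have "(norm (u - v))\<^sup>2 \<le> 4 * (m + 1 - M)" using \<phi>_ge[of v] by simp
      then have "norm (u - v) \<le> sqrt (4 * (m + 1 - M))" by (rule real_le_rsqrt)
      then show "norm v \<le> norm u + sqrt (4 * (m + 1 - M))"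
        using norm_triangle_ineq2[of v u] by (simp add: norm_minus_commute)
    qed
  qed
  then obtain p where p: "\<And>n. p \<in> K n" by blast
  have "\<phi> p \<le> m + e" if e: "e > 0" for e
  proof -
    obtain n where "1 / real (Suc n) < e" using nat_approx_posE[OF e] by blast
    moreover have "\<phi> p \<le> m + 1 / real (Suc n)" using p[of n] by (simp add: K_def)
    ultimately show ?thesis by linarith
  qed
  then have "\<phi> p \<le> m" by (rule field_le_epsilon)
  then show ?thesis using p[of 0] m_le unfolding \<phi>_def K_def by force
qed

text \<open>Test with \<open>p + s *\<^sub>R (u - p)\<close>, bound \<open>g\<close> there by
  convexity, divide by \<open>s\<close>, and use continuity of \<open>T\<close> as \<open>s\<close>
  tends to zero.\<close>

lemma minty:
  fixes g :: "'a::real_inner \<Rightarrow> real"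
  assumes g: "convex_on D g" and T: "continuous_on UNIV T" and p: "p \<in> D"
    and weak: "\<And>u. u \<in> D \<Longrightarrow> g p \<le> T u \<bullet> (u - p) + g u"
    and u: "u \<in> D"
  shows "g p \<le> T p \<bullet> (u - p) + g u"
proof -
  have "0 \<le> T (p + 0 *\<^sub>R (u - p)) \<bullet> (u - p) + g u - g p"
  proof (rule nonneg_if_right_limit_nonneg)
    have "isCont T (p + 0 *\<^sub>R (u - p))"
      using T by (simp add: continuous_on_eq_continuous_at)
    then show "((\<lambda>s. T (p + s *\<^sub>R (u - p)) \<bullet> (u - p) + g u - g p) \<longlongrightarrow>
        T (p + 0 *\<^sub>R (u - p)) \<bullet> (u - p) + g u - g p) (at_right 0)"
      by (intro tendsto_intros isCont_tendsto_compose[of _ T]) auto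
    fix s :: real assume s: "0 < s" "s \<le> 1"
    define v where "v = (1 - s) *\<^sub>R p + s *\<^sub>R u"
    have v: "v = p + s *\<^sub>R (u - p)" by (simp add: v_def algebra_simps)
    have "v \<in> D" unfolding v_def using convex_on_imp_convex[OF g] p u s by (intro convexD) auto
    then have "g p \<le> T v \<bullet> (v - p) + g v" by (rule weak)
    also have "T v \<bullet> (v - p) = s * (T v \<bullet> (u - p))" by (simp add: v)
    also have "g v \<le> (1 - s) * g p + s * g u"
      unfolding v_def using s p u by (intro convex_onD[OF g]) auto
    finally have "0 \<le> s * (T v \<bullet> (u - p) + g u - g p)" by (simp add: algebra_simps)
    then show "0 \<le> T (p + s *\<^sub>R (u - p)) \<bullet> (u - p) + g u - g p"
      using s by (simp add: zero_le_mult_iff v)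
  qed
  then show ?thesis by simp
qed

section \<open>The flow\<close>

text \<open>The real-valued setting: \<open>D\<close> stands for the effective domain and
  \<open>g\<close> for the finite values of \<open>h\<close>. The proximal map enters only through
  its variational inequality, the step size only through \<open>lam * \<beta> < 1\<close>, and
  \<open>N\<close> contains the times at which the differential equation may fail.\<close>

locale forward_backward_forward_flow =
  fixes D :: "'a::{real_inner, complete_space} set" and g :: "'a \<Rightarrow> real" and T :: "'a \<Rightarrow> 'a"
    and \<beta> lam :: real and x y :: "real \<Rightarrow> 'a" and N :: "real set"
  assumes g_convex: "convex_on D g"
    and g_closed: "\<And>c. continuous_on UNIV c \<Longrightarrow> closed {v \<in> D. g v \<le> c v}"
    and T_lip: "\<beta>-lipschitz_on UNIV T"
    and T_mono: "\<And>u v. u \<in> D \<Longrightarrow> v \<in> D \<Longrightarrow> 0 \<le> (T u - T v) \<bullet> (u - v)"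
    and lam_pos: "0 < lam" and lam_\<beta>: "lam * \<beta> < 1"
    and y_in: "\<And>t. 0 \<le> t \<Longrightarrow> y t \<in> D"
    and y_prox: "\<And>t w. 0 \<le> t \<Longrightarrow> w \<in> D \<Longrightarrow>
      (x t - lam *\<^sub>R T (x t) - y t) \<bullet> (w - y t) \<le> lam * (g w - g (y t))"
    and x_ac: "locally_absolutely_continuous x"
    and N_null: "negligible N"
    and x_deriv: "\<And>t. 0 \<le> t \<Longrightarrow> t \<notin> N \<Longrightarrow>
      (x has_vector_derivative (y t - x t + lam *\<^sub>R (T (x t) - T (y t)))) (at t within {0..})"
begin

definition solutions :: "'a set" where
  "solutions = {z \<in> D. \<forall>u\<in>D. g z \<le> T z \<bullet> (u - z) + g u}"

abbreviation velocity :: "real \<Rightarrow> 'a" where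
  "velocity t \<equiv> y t - x t + lam *\<^sub>R (T (x t) - T (y t))"

lemma \<beta>_nonneg: "0 \<le> \<beta>"
  using T_lip by (rule lipschitz_on_nonneg)

lemma T_norm: "norm (T u - T v) \<le> \<beta> * norm (u - v)"
  using lipschitz_onD[OF T_lip, of u v] by (simp add: dist_norm)

lemma lam_T_norm: "norm (lam *\<^sub>R (T u - T v)) \<le> lam * \<beta> * norm (u - v)"
  using mult_left_mono[OF T_norm, of lam u v] lam_pos by (simp add: mult.assoc)

lemma x_ac_on: "0 \<le> a \<Longrightarrow> absolutely_continuous_on_ivl a b x"
  using x_ac absolutely_continuous_on_ivl_subset[of 0 "max b 1" x a b]
  by (auto simp: locally_absolutely_continuous_def)

lemma y_Lipschitz:
  assumes s: "0 \<le> s" and t: "0 \<le> t"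
  shows "norm (y s - y t) \<le> (1 + lam * \<beta>) * norm (x s - x t)"
proof -
  define u where "u t = x t - lam *\<^sub>R T (x t)" for t
  \<comment> \<open>Each proximal inequality is tested with the other proximal point; in the sum the
    values of \<open>g\<close> cancel. This yields nonexpansiveness of the proximal map.\<close>
  have "(u s - y s) \<bullet> (y t - y s) + (u t - y t) \<bullet> (y s - y t) \<le> 0"
    using y_prox[OF s y_in[OF t]] y_prox[OF t y_in[OF s]] unfolding u_def
    by (simp add: algebra_simps)
  then have "(y s - y t) \<bullet> (y s - y t) \<le> (u s - u t) \<bullet> (y s - y t)"
    by (simp add: inner_diff_left inner_diff_right inner_commute)
  also have "\<dots> \<le> norm (u s - u t) * norm (y s - y t)" by (rule norm_cauchy_schwarz)
  finally have "norm (y s - y t) * norm (y s - y t) \<le> norm (u s - u t) * norm (y s - y t)"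
    by (simp add: norm_eq_sqrt_inner)
  then have "norm (y s - y t) \<le> norm (u s - u t)"
    by (cases "norm (y s - y t) = 0") (auto simp: mult_le_cancel_right)
  also have "u s - u t = (x s - x t) - lam *\<^sub>R (T (x s) - T (x t))"
    by (simp add: u_def algebra_simps)
  also have "norm \<dots> \<le> norm (x s - x t) + lam * \<beta> * norm (x s - x t)"
    using norm_triangle_ineq4 lam_T_norm by (meson add_left_mono order_trans)
  finally show ?thesis by (simp add: algebra_simps)
qed

lemma velocity_norm: "norm (velocity t) \<le> (1 + lam * \<beta>) * norm (x t - y t)"
proof -
  have "norm (velocity t) \<le> norm (y t - x t) + lam * \<beta> * norm (x t - y t)"
    using norm_triangle_ineq lam_T_norm by (meson add_left_mono order_trans)
  then show ?thesis by (simp add: algebra_simps norm_minus_commute)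
qed

lemma lyapunov_derivative:
  assumes z: "z \<in> solutions" and t: "0 \<le> t"
  shows "(x t - z) \<bullet> velocity t \<le> - (1 - lam * \<beta>) * (norm (x t - y t))\<^sup>2"
proof -
  have zD: "z \<in> D" using z by (simp add: solutions_def)
  have "g z \<le> T z \<bullet> (y t - z) + g (y t)" using z y_in[OF t] by (simp add: solutions_def)
  also have "T z \<bullet> (y t - z) \<le> T (y t) \<bullet> (y t - z)"
    using T_mono[OF y_in[OF t] zD] by (simp add: inner_diff_left)
  finally have "lam * (g z - g (y t)) \<le> lam * (T (y t) \<bullet> (y t - z))" using lam_pos by simp
  then have "(x t - lam *\<^sub>R T (x t) - y t) \<bullet> (z - y t) \<le> lam * (T (y t) \<bullet> (y t - z))"
    using y_prox[OF t zD] by linarith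
  \<comment> \<open>The correction term in the velocity replaces \<open>T (x t)\<close> by
    \<open>T (y t)\<close>, which is the value that monotonicity controls.\<close>
  then have 1: "(y t - z) \<bullet> velocity t \<le> 0"
    by (simp add: inner_diff_left inner_diff_right inner_add_right inner_add_left inner_commute algebra_simps)
  have "(x t - y t) \<bullet> (lam *\<^sub>R (T (x t) - T (y t))) \<le> norm (x t - y t) * (lam * \<beta> * norm (x t - y t))"
    using norm_cauchy_schwarz lam_T_norm by (meson mult_left_mono norm_ge_zero order_trans)
  moreover have "(x t - y t) \<bullet> velocity t
      = - (norm (x t - y t))\<^sup>2 + (x t - y t) \<bullet> (lam *\<^sub>R (T (x t) - T (y t)))"
    unfolding inner_add_right power2_norm_eq_inner
    by (simp add: inner_diff_left inner_diff_right inner_commute)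
  ultimately have 2: "(x t - y t) \<bullet> velocity t \<le> - (1 - lam * \<beta>) * (norm (x t - y t))\<^sup>2"
    by (simp add: power2_eq_square algebra_simps)
  have "(x t - z) \<bullet> velocity t = (x t - y t) \<bullet> velocity t + (y t - z) \<bullet> velocity t"
    unfolding inner_add_left[symmetric] by simp
  with 1 2 show ?thesis by linarith
qed

text \<open>The integrated form of the derivative estimate. With \<open>c = 0\<close> it gives
  monotone distances; with a positive \<open>c\<close> it charges a definite decrease to every time
  interval on which the residual stays large.\<close>

lemma lyapunov_decrease:
  assumes z: "z \<in> solutions" and a: "0 \<le> a" and ab: "a \<le> b"
    and c: "\<And>t. a \<le> t \<Longrightarrow> t \<le> b \<Longrightarrow> c \<le> (norm (x t - y t))\<^sup>2"
  shows "(norm (x b - z))\<^sup>2 + 2 * (1 - lam * \<beta>) * c * (b - a) \<le> (norm (x a - z))\<^sup>2"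
proof -
  define V where "V t = (norm (x t - z))\<^sup>2" for t
  have V: "V t = (x t - z) \<bullet> (x t - z)" for t by (simp add: V_def power2_norm_eq_inner)
  \<comment> \<open>On a bounded set the squared distance is Lipschitz in \<open>x\<close>, so
    \<open>V\<close> inherits absolute continuity from \<open>x\<close>.\<close>
  have "bounded ((\<lambda>t. x t - z) ` {a..b})"
    by (intro compact_imp_bounded compact_continuous_image continuous_intros
        absolutely_continuous_on_ivl_imp_continuous_on x_ac_on a) auto
  then obtain B where B: "\<And>t. t \<in> {a..b} \<Longrightarrow> norm (x t - z) \<le> B"
    unfolding bounded_iff by blast
  have "V b - V a \<le> (- 2 * (1 - lam * \<beta>) * c) * (b - a)"
  proof (rule absolutely_continuous_deriv_le[OF _ ab N_null])
    show "absolutely_continuous_on_ivl a b V"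
    proof (rule absolutely_continuous_on_ivl_dominated[OF x_ac_on[OF a]])
      fix s t assume st: "s \<in> {a..b}" "t \<in> {a..b}"
      have "V t - V s = ((x t - z) + (x s - z)) \<bullet> (x t - x s)"
        by (simp add: V inner_diff_left inner_diff_right inner_add_left inner_add_right inner_commute)
      then have "norm (V t - V s) \<le> norm ((x t - z) + (x s - z)) * norm (x t - x s)"
        using Cauchy_Schwarz_ineq2 by simp
      also have "norm ((x t - z) + (x s - z)) \<le> 2 * B"
        using norm_triangle_ineq[of "x t - z" "x s - z"] B[OF st(1)] B[OF st(2)] by linarith
      finally show "norm (V t - V s) \<le> 2 * B * norm (x t - x s)"
        by (simp add: mult_right_mono)
    qed
    fix t assume t: "t \<in> {a..b} - N"
    then have t0: "0 \<le> t" using a by simp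
    have dx: "(x has_vector_derivative velocity t) (at t within {a..b})"
      by (rule has_vector_derivative_within_subset[OF x_deriv]) (use t a in auto)
    have dxz: "((\<lambda>t. x t - z) has_vector_derivative velocity t) (at t within {a..b})"
      by (rule derivative_eq_intros dx refl)+ simp
    have "((\<lambda>t. (x t - z) \<bullet> (x t - z)) has_vector_derivative
        (x t - z) \<bullet> velocity t + velocity t \<bullet> (x t - z)) (at t within {a..b})"
      by (rule bounded_bilinear.has_vector_derivative[OF bounded_bilinear_inner dxz dxz])
    then have "(V has_real_derivative 2 * ((x t - z) \<bullet> velocity t)) (at t within {a..b})"
      by (simp add: V[abs_def] has_real_derivative_iff_has_vector_derivative inner_commute)
    moreover have "(1 - lam * \<beta>) * c \<le> (1 - lam * \<beta>) * (norm (x t - y t))\<^sup>2"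
      using c[of t] t lam_\<beta> by (intro mult_left_mono) auto
    ultimately show "\<exists>E\<le>- 2 * (1 - lam * \<beta>) * c. (V has_real_derivative E) (at t within {a..b})"
      using lyapunov_derivative[OF z t0]
      by (intro exI[of _ "2 * ((x t - z) \<bullet> velocity t)"]) (simp add: algebra_simps)
  qed
  then show ?thesis unfolding V_def by argo
qed

lemma dist_antimono:
  assumes "z \<in> solutions" and "0 \<le> a" and "a \<le> b"
  shows "norm (x b - z) \<le> norm (x a - z)"
proof (rule power2_le_imp_le)
  show "(norm (x b - z))\<^sup>2 \<le> (norm (x a - z))\<^sup>2"
    using lyapunov_decrease[OF assms, of 0] by simp
qed simp

lemma dist_converges:
  assumes z: "z \<in> solutions"
  shows "\<exists>l. ((\<lambda>t. norm (x t - z)) \<longlongrightarrow> l) at_top"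
proof -
  define l where "l = (INF t\<in>{0..}. norm (x t - z))"
  have bb: "bdd_below ((\<lambda>t. norm (x t - z)) ` {0..})" by (rule bdd_belowI[of _ 0]) auto
  have "((\<lambda>t. norm (x t - z)) \<longlongrightarrow> l) at_top"
  proof (rule order_tendstoI)
    fix c assume "c < l"
    then have "c < norm (x t - z)" if "0 \<le> t" for t
      using cINF_lower[OF bb, of t] that unfolding l_def by force
    then show "\<forall>\<^sub>F t in at_top. c < norm (x t - z)"
      by (auto simp: eventually_at_top_linorder)
  next
    fix c assume "l < c"
    then obtain s where s: "0 \<le> s" "norm (x s - z) < c"
      unfolding l_def using cINF_less_iff[OF _ bb] by (metis atLeast_iff empty_iff order_refl)
    then have "norm (x t - z) < c" if "s \<le> t" for t
      using dist_antimono[OF z s(1) that] by simp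
    then show "\<forall>\<^sub>F t in at_top. norm (x t - z) < c"
      by (auto simp: eventually_at_top_linorder)
  qed
  then show ?thesis by blast
qed

lemma x_bounded:
  assumes z: "z \<in> solutions" and t: "0 \<le> t"
  shows "norm (x t - x 0) \<le> 2 * norm (x 0 - z)"
proof -
  have "norm (x t - x 0) = norm ((x t - z) - (x 0 - z))" by simp
  then show ?thesis
    using norm_triangle_ineq4[of "x t - z" "x 0 - z"] dist_antimono[OF z order_refl t] by linarith
qed

text \<open>The constant adds \<open>1\<close> for \<open>x\<close> and
  \<open>1 + lam * \<beta>\<close> for \<open>y\<close>. It serves both to bound the residual for
  all times and to keep a large residual large for a while.\<close>

lemma residual_Lipschitz:
  assumes "0 \<le> s" and "0 \<le> t"
  shows "norm (x s - y s) \<le> norm (x t - y t) + (2 + lam * \<beta>) * norm (x s - x t)"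
proof -
  have "norm (x s - y s) = norm ((x t - y t) + ((x s - x t) - (y s - y t)))"
    by (rule arg_cong[of _ _ norm]) (simp add: algebra_simps)
  then have "norm (x s - y s) \<le> norm (x t - y t) + (norm (x s - x t) + norm (y s - y t))"
    using norm_triangle_ineq[of "x t - y t" "(x s - x t) - (y s - y t)"]
      norm_triangle_ineq4[of "x s - x t" "y s - y t"] by linarith
  then show ?thesis using y_Lipschitz[OF assms] by (simp add: algebra_simps)
qed

text \<open>If the residual is at least \<open>e\<close> at a late time \<open>t\<close>, it stays
  above \<open>e / 2\<close> for a fixed duration \<open>\<delta>\<close>, and the squared distance
  to \<open>z\<close> drops by a fixed \<open>\<eta>\<close>. This contradicts convergence of that
  distance.\<close>

lemma residual_tendsto_0:
  assumes z: "z \<in> solutions"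
  shows "((\<lambda>t. x t - y t) \<longlongrightarrow> 0) at_top"
proof -
  define R where "R = norm (x 0 - y 0) + (2 + lam * \<beta>) * (2 * norm (x 0 - z))"
  have k0: "0 \<le> lam * \<beta>" using lam_pos \<beta>_nonneg by simp
  have R: "norm (x t - y t) \<le> R" if "0 \<le> t" for t
    using residual_Lipschitz[OF that order_refl] mult_left_mono[OF x_bounded[OF z that], of "2 + lam * \<beta>"] k0
    unfolding R_def by linarith
  \<comment> \<open>A Lipschitz constant of the residual in time:
    \<open>(1 + lam * \<beta>) * R\<close> bounds the speed of \<open>x\<close>.\<close>
  define L where "L = (2 + lam * \<beta>) * ((1 + lam * \<beta>) * R)"
  have "0 \<le> R" using order_trans[OF norm_ge_zero R[OF order_refl]] .
  then have L0: "0 \<le> L" using k0 by (simp add: L_def)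
  have x_Lip: "norm (x b - x a) \<le> (1 + lam * \<beta>) * R * (b - a)" if a: "0 \<le> a" and ab: "a \<le> b" for a b
  proof (rule absolutely_continuous_deriv_norm_le[OF x_ac_on[OF a] ab N_null])
    fix t assume t: "t \<in> {a..b} - N"
    have "norm (velocity t) \<le> (1 + lam * \<beta>) * norm (x t - y t)" by (rule velocity_norm)
    also have "\<dots> \<le> (1 + lam * \<beta>) * R" using R[of t] t a k0 by (intro mult_left_mono) auto
    finally have "norm (velocity t) \<le> (1 + lam * \<beta>) * R" .
    moreover have "(x has_vector_derivative velocity t) (at t within {a..b})"
      by (rule has_vector_derivative_within_subset[OF x_deriv]) (use t a in auto)
    ultimately show "\<exists>f'. norm f' \<le> (1 + lam * \<beta>) * R \<and> (x has_vector_derivative f') (at t within {a..b})"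
      by blast
  qed
  show ?thesis
  proof (rule tendstoI)
    fix e :: real assume e: "0 < e"
    \<comment> \<open>Chosen so that the residual changes by at most \<open>e / 2\<close> within
      time \<open>\<delta>\<close>; \<open>L + 1\<close> avoids division by zero.\<close>
    define \<delta> where "\<delta> = e / (2 * (L + 1))"
    have \<delta>: "0 < \<delta>" "L * \<delta> \<le> e / 2" using e L0 by (auto simp: \<delta>_def field_simps)
    define \<eta> where "\<eta> = 2 * (1 - lam * \<beta>) * (e / 2)\<^sup>2 * \<delta>"
    have \<eta>: "0 < \<eta>" using lam_\<beta> e \<delta>(1) by (simp add: \<eta>_def)
    obtain l where "((\<lambda>t. norm (x t - z)) \<longlongrightarrow> l) at_top" using dist_converges[OF z] by blast
    then have "((\<lambda>t. (norm (x t - z))\<^sup>2) \<longlongrightarrow> l\<^sup>2) at_top" by (rule tendsto_power)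
    then have "\<forall>\<^sub>F t in at_top. dist ((norm (x t - z))\<^sup>2) (l\<^sup>2) < \<eta> / 2"
      using \<eta> by (intro tendstoD) auto
    then obtain s where s: "\<And>t. s \<le> t \<Longrightarrow> dist ((norm (x t - z))\<^sup>2) (l\<^sup>2) < \<eta> / 2"
      by (auto simp: eventually_at_top_linorder)
    have "norm (x t - y t) < e" if t: "max 0 s \<le> t" for t
    proof (rule ccontr)
      assume "\<not> norm (x t - y t) < e"
      have "(e / 2)\<^sup>2 \<le> (norm (x r - y r))\<^sup>2" if r: "t \<le> r" "r \<le> t + \<delta>" for r
      proof (rule power_mono)
        have "norm (x t - x r) \<le> (1 + lam * \<beta>) * R * (r - t)"
          using x_Lip[of t r] t r by (simp add: norm_minus_commute)
        then have "(2 + lam * \<beta>) * norm (x t - x r) \<le> L * (r - t)"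
          using mult_left_mono[of _ _ "2 + lam * \<beta>"] k0 by (fastforce simp: L_def mult.assoc)
        also have "\<dots> \<le> L * \<delta>" using L0 r by (intro mult_left_mono) auto
        also have "\<dots> \<le> e / 2" by (rule \<delta>(2))
        finally show "e / 2 \<le> norm (x r - y r)"
          using residual_Lipschitz[of t r] t r \<open>\<not> norm (x t - y t) < e\<close> by linarith
      qed (use e in simp)
      then have "(norm (x (t + \<delta>) - z))\<^sup>2 + \<eta> \<le> (norm (x t - z))\<^sup>2"
        using lyapunov_decrease[OF z, of t "t + \<delta>" "(e / 2)\<^sup>2"] t \<delta>(1) unfolding \<eta>_def by simp
      moreover have "dist ((norm (x t - z))\<^sup>2) (l\<^sup>2) < \<eta> / 2" "dist ((norm (x (t + \<delta>) - z))\<^sup>2) (l\<^sup>2) < \<eta> / 2"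
        using s t \<delta>(1) by auto
      ultimately show False unfolding dist_real_def by linarith
    qed
    then show "\<forall>\<^sub>F t in at_top. dist (x t - y t) 0 < e"
      unfolding eventually_at_top_linorder by (intro exI[of _ "max 0 s"]) simp
  qed
qed

text \<open>In the proximal inequality tested with \<open>u\<close>, \<open>T (x t)\<close> is
  replaced by \<open>T (y t)\<close> at the cost of a Lipschitz error, and then by
  \<open>T u\<close> through monotonicity. With \<open>T\<close> at a fixed point, the main part is
  a convex condition on \<open>y t\<close>, which survives passage to closed convex hulls.\<close>

lemma minty_residual:
  assumes u: "u \<in> D" and t: "0 \<le> t"
  shows "g (y t) \<le> T u \<bullet> (u - y t) + g u + (1 / lam + \<beta>) * (norm (x t - y t) * norm (u - y t))"
proof -
  have "(x t - lam *\<^sub>R T (x t) - y t) \<bullet> (u - y t)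
      = (x t - y t) \<bullet> (u - y t) - lam * ((T (x t) - T (y t)) \<bullet> (u - y t)) - lam * (T (y t) \<bullet> (u - y t))"
    by (simp add: algebra_simps)
  moreover have "- ((x t - y t) \<bullet> (u - y t)) \<le> norm (x t - y t) * norm (u - y t)"
    using Cauchy_Schwarz_ineq2[of "x t - y t" "u - y t"] by linarith
  moreover have "(T (x t) - T (y t)) \<bullet> (u - y t) \<le> \<beta> * norm (x t - y t) * norm (u - y t)"
    using norm_cauchy_schwarz T_norm by (meson mult_right_mono norm_ge_zero order_trans)
  then have "lam * ((T (x t) - T (y t)) \<bullet> (u - y t)) \<le> lam * (\<beta> * norm (x t - y t) * norm (u - y t))"
    using lam_pos by simp
  moreover have "T (y t) \<bullet> (u - y t) \<le> T u \<bullet> (u - y t)"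
    using T_mono[OF u y_in[OF t]] by (simp add: inner_diff_left)
  then have "lam * (T (y t) \<bullet> (u - y t)) \<le> lam * (T u \<bullet> (u - y t))"
    using lam_pos by simp
  ultimately have "lam * g (y t) \<le> lam * (T u \<bullet> (u - y t)) + lam * g u
      + (norm (x t - y t) * norm (u - y t) + lam * (\<beta> * norm (x t - y t) * norm (u - y t)))"
    using y_prox[OF t u] unfolding right_diff_distrib by linarith
  also have "\<dots> = lam * (T u \<bullet> (u - y t) + g u + (1 / lam + \<beta>) * (norm (x t - y t) * norm (u - y t)))"
    using lam_pos by (simp add: field_simps)
  finally show ?thesis using lam_pos by simp
qed

lemma y_bounded:
  assumes z: "z \<in> solutions"
  shows "bounded (y ` {0..})"
proof (rule boundedI)
  have k0: "0 \<le> lam * \<beta>" using lam_pos \<beta>_nonneg by simp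
  fix v assume "v \<in> y ` {0..}"
  then obtain t where t: "0 \<le> t" and v: "v = y t" by auto
  have "norm (y t - y 0) \<le> (1 + lam * \<beta>) * (2 * norm (x 0 - z))"
    using y_Lipschitz[OF t order_refl] mult_left_mono[OF x_bounded[OF z t], of "1 + lam * \<beta>"] k0 by linarith
  then show "norm v \<le> norm (y 0) + (1 + lam * \<beta>) * (2 * norm (x 0 - z))"
    unfolding v using norm_triangle_ineq2[of "y t" "y 0"] by linarith
qed

lemma convex_hull_cluster_point_is_solution:
  assumes z: "z \<in> solutions"
    and p: "\<And>n::nat. p \<in> closure (convex hull (y ` {real n..}))"
  shows "p \<in> solutions"
proof -
  have mem: "p \<in> D \<and> g p \<le> T u \<bullet> (u - p) + g u + e" if u: "u \<in> D" and e: "0 < e" for u e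
  proof -
    obtain B where B: "\<And>t. 0 \<le> t \<Longrightarrow> norm (y t) \<le> B"
      using y_bounded[OF z] by (auto simp: bounded_iff)
    have B0: "0 \<le> B" using B[of 0] norm_ge_zero order_trans by blast
    define M where "M = (1 / lam + \<beta>) * (norm u + B)"
    have lb: "0 \<le> 1 / lam + \<beta>" using lam_pos \<beta>_nonneg by simp
    have "0 \<le> M" using lb B0 unfolding M_def by simp
    have "((\<lambda>t. M * norm (x t - y t)) \<longlongrightarrow> M * norm (0::'a)) at_top"
      by (intro tendsto_intros residual_tendsto_0[OF z])
    then have "\<forall>\<^sub>F t in at_top. M * norm (x t - y t) < e"
      using e by (intro order_tendstoD) auto
    then obtain s where s: "\<And>t. s \<le> t \<Longrightarrow> M * norm (x t - y t) < e"
      by (auto simp: eventually_at_top_linorder)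
    obtain n :: nat where n: "s \<le> real n" using real_arch_simple by blast
    define K where "K = {v \<in> D. g v \<le> T u \<bullet> (u - v) + g u + e}"
    have "closure (convex hull (y ` {real n..})) \<subseteq> K"
    proof (intro closure_minimal hull_minimal image_subsetI)
      fix t assume "t \<in> {real n..}"
      then have t: "0 \<le> t" "s \<le> t" using n by auto
      have "norm (u - y t) \<le> norm u + B" using norm_triangle_ineq4[of u "y t"] B[OF t(1)] by linarith
      then have "(1 / lam + \<beta>) * (norm (x t - y t) * norm (u - y t)) \<le> (1 / lam + \<beta>) * (norm (x t - y t) * (norm u + B))"
        using lb by (intro mult_left_mono) auto
      also have "\<dots> = M * norm (x t - y t)" by (simp add: M_def)
      finally show "y t \<in> K"
        unfolding K_def using minty_residual[OF u t(1)] s[OF t(2)] y_in[OF t(1)] by simp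
    next
      show "closed K" unfolding K_def by (intro g_closed continuous_intros)
      have "convex_on D (\<lambda>v. g v + T u \<bullet> v)"
        using convex_on_imp_convex[OF g_convex]
        by (intro convex_on_add g_convex) (simp add: convex_on_def inner_add_right)
      from convex_sublevel[OF this, of "T u \<bullet> u + g u + e"] show "convex K"
        unfolding K_def by (simp add: inner_diff_right algebra_simps)
    qed
    then show ?thesis using p[of n] unfolding K_def by blast
  qed
  have zD: "z \<in> D" using z by (simp add: solutions_def)
  \<comment> \<open>An effective domain need not be closed; \<open>p\<close> lies in it because the
    closed set \<open>K\<close> of approximate solutions is contained in \<open>D\<close>.\<close>
  have pD: "p \<in> D" using mem[OF zD, of 1] by simp
  have "g p \<le> T u \<bullet> (u - p) + g u" if u: "u \<in> D" for u
  proof (rule field_le_epsilon)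
    show "g p \<le> T u \<bullet> (u - p) + g u + e" if "0 < e" for e
      using mem[OF u that] by simp
  qed
  then have "g p \<le> T p \<bullet> (u - p) + g u" if "u \<in> D" for u
    using that by (intro minty[OF g_convex lipschitz_on_continuous_on[OF T_lip] pD])
  then show ?thesis using pD by (simp add: solutions_def)
qed

text \<open>The limit is found along \<open>y\<close>, whose values lie in \<open>D\<close>, unlike
  those of \<open>x\<close> in general. Distances and functionals along \<open>x\<close> and
  \<open>y\<close> differ by quantities controlled by the vanishing residual.\<close>

lemma weak_convergence:
  assumes "solutions \<noteq> {}"
  shows "\<exists>z\<in>solutions. weakly_converges x z at_top \<and> weakly_converges y z at_top"
proof -
  obtain z0 where z0: "z0 \<in> solutions" using assms by blast
  note r0 = residual_tendsto_0[OF z0]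
  have "\<exists>z\<in>solutions. weakly_converges y z at_top"
  proof (rule weakly_converges_if_dist_converges[OF y_bounded[OF z0]])
    fix z assume z: "z \<in> solutions"
    obtain l where l: "((\<lambda>t. norm (x t - z)) \<longlongrightarrow> l) at_top" using dist_converges[OF z] by blast
    have "((\<lambda>t. norm (y t - z) - norm (x t - z)) \<longlongrightarrow> 0) at_top"
    proof (rule Lim_null_comparison)
      show "\<forall>\<^sub>F t in at_top. norm (norm (y t - z) - norm (x t - z)) \<le> norm (x t - y t)"
        using norm_triangle_ineq3[of "y t - z" "x t - z" for t] by (simp add: norm_minus_commute)
      show "((\<lambda>t. norm (x t - y t)) \<longlongrightarrow> 0) at_top" using r0 by (rule tendsto_norm_zero)
    qed
    from tendsto_add[OF this l] show "\<exists>l. ((\<lambda>t. norm (y t - z)) \<longlongrightarrow> l) at_top" by auto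
  qed (rule convex_hull_cluster_point_is_solution[OF z0])
  then obtain z where z: "z \<in> solutions" and y: "weakly_converges y z at_top" by blast
  have "weakly_converges x z at_top"
    unfolding weakly_converges_def
  proof (intro allI impI)
    fix f :: "'a \<Rightarrow> real" assume f: "bounded_linear f"
    have "((\<lambda>t. f (y t) + f (x t - y t)) \<longlongrightarrow> f z + f 0) at_top"
      using y f by (intro tendsto_add bounded_linear.tendsto[OF f r0]) (simp add: weakly_converges_def)
    then show "((\<lambda>t. f (x t)) \<longlongrightarrow> f z) at_top"
      using f by (simp add: linear_diff linear_0 bounded_linear.linear)
  qed
  with z y show ?thesis by blast
qed

end

section \<open>Extended real-valued functions\<close>

text \<open>A real number strictly between \<open>c v\<close> and \<open>h v\<close> would separate
  \<open>c\<close> from \<open>h\<close> near a limit point \<open>v\<close> that violates the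
  inequality. A continuous \<open>c\<close> covers both the proximal objective and Minty's
  inequality.\<close>

lemma lsc_on_closed_sublevel:
  fixes h :: "'a::t1_space \<Rightarrow> ereal" and c :: "'a \<Rightarrow> real"
  assumes C: "closed C" and h: "lsc_on C h" and c: "continuous_on UNIV c"
  shows "closed {v \<in> C. h v \<le> ereal (c v)}" (is "closed ?A")
  unfolding closed_limpt
proof (intro allI impI)
  fix v assume v: "v islimpt ?A"
  then have "v islimpt C" by (rule islimpt_subset) auto
  then have vC: "v \<in> C" using C by (simp add: closed_limpt)
  have "h v \<le> ereal (c v)"
  proof (rule ccontr)
    assume "\<not> h v \<le> ereal (c v)"
    then have "ereal (c v) < h v" by simp
    then obtain r where r: "ereal (c v) < ereal r" "ereal r < h v"
      using ereal_dense2 by blast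
    have "ereal r < Liminf (at v within C) h"
      using h vC r(2) unfolding lsc_on_def by (metis order_less_le_trans)
    then have "\<forall>\<^sub>F w in at v within C. ereal r < h w" by (rule less_LiminfD)
    then have 1: "\<forall>\<^sub>F w in at v within ?A. ereal r < h w"
      by (rule filter_leD[OF at_le, rotated]) auto
    have "(c \<longlongrightarrow> c v) (at v within ?A)"
      using c by (meson UNIV_I continuous_on_def subset_UNIV tendsto_within_subset)
    then have 2: "\<forall>\<^sub>F w in at v within ?A. c w < r"
      using r(1) by (intro order_tendstoD) auto
    have 3: "\<forall>\<^sub>F w in at v within ?A. w \<in> ?A" by (auto simp: eventually_at_filter)
    have "\<forall>\<^sub>F w in at v within ?A. False"
      using 1 2 3
    proof eventually_elim
      case (elim w)
      from elim(3) have "h w \<le> ereal (c w)" by simp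
      with elim(1) have "ereal r < ereal (c w)" by (rule less_le_trans)
      with elim(2) show False by simp
    qed
    then show False using v by (simp add: trivial_limit_def[symmetric] trivial_limit_within)
  qed
  with vC show "v \<in> ?A" by simp
qed

lemma proper_on_eff_dom_ereal:
  assumes "proper_on C h" and "v \<in> eff_dom C h"
  shows "h v = ereal (real_of_ereal (h v))"
  using assms by (cases "h v") (auto simp: proper_on_def eff_dom_def)

lemma ereal_convex_on_real:
  assumes "proper_on C h" and h: "ereal_convex_on C h"
  shows "convex_on (eff_dom C h) (\<lambda>v. real_of_ereal (h v))"
proof (rule convex_onI)
  show D: "convex (eff_dom C h)" using h by (simp add: ereal_convex_on_def)
  fix s :: real and v w assume s: "0 < s" "s < 1" and v: "v \<in> eff_dom C h" and w: "w \<in> eff_dom C h"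
  note real = proper_on_eff_dom_ereal[OF assms(1)]
  have "(1 - s) *\<^sub>R v + s *\<^sub>R w \<in> eff_dom C h" using D v w s by (intro convexD) auto
  then have "ereal (real_of_ereal (h ((1 - s) *\<^sub>R v + s *\<^sub>R w))) = h ((1 - s) *\<^sub>R v + s *\<^sub>R w)"
    by (rule real[symmetric])
  also have "h ((1 - s) *\<^sub>R v + s *\<^sub>R w) \<le> ereal (1 - s) * h v + ereal s * h w"
  proof -
    have "\<forall>\<alpha>\<in>{0..1::real}. h (\<alpha> *\<^sub>R v + (1 - \<alpha>) *\<^sub>R w) \<le> ereal \<alpha> * h v + ereal (1 - \<alpha>) * h w"
      using h v w unfolding ereal_convex_on_def by blast
    from bspec[OF this, of "1 - s"] s show ?thesis by simp
  qed
  also have "ereal (1 - s) * h v + ereal s * h w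
      = ereal ((1 - s) * real_of_ereal (h v) + s * real_of_ereal (h w))"
    by (subst real[OF v], subst real[OF w]) simp
  finally show "real_of_ereal (h ((1 - s) *\<^sub>R v + s *\<^sub>R w))
      \<le> (1 - s) * real_of_ereal (h v) + s * real_of_ereal (h w)"
    by (simp only: ereal_less_eq)
qed

text \<open>Test points outside the effective domain make the left-hand side infinite, so only
  finite values have to be compared.\<close>

lemma mvi_solutions_real:
  assumes "proper_on C h"
  shows "mvi_solutions C T h =
    {z \<in> eff_dom C h. \<forall>u\<in>eff_dom C h. real_of_ereal (h z) \<le> T z \<bullet> (u - z) + real_of_ereal (h u)}"
proof -
  note real = proper_on_eff_dom_ereal[OF assms]
  have eq: "(\<forall>u\<in>C. 0 \<le> ereal (T z \<bullet> (u - z)) + h u - h z) \<longleftrightarrow>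
      (\<forall>u\<in>eff_dom C h. real_of_ereal (h z) \<le> T z \<bullet> (u - z) + real_of_ereal (h u))"
    if z: "z \<in> eff_dom C h" for z
  proof -
    have inf: "0 \<le> ereal (T z \<bullet> (u - z)) + h u - h z" if "u \<in> C" "u \<notin> eff_dom C h" for u
    proof -
      have "h u = \<infinity>" using that by (simp add: eff_dom_def)
      then show ?thesis by (subst real[OF z]) simp
    qed
    have fin: "0 \<le> ereal (T z \<bullet> (u - z)) + h u - h z \<longleftrightarrow>
        real_of_ereal (h z) \<le> T z \<bullet> (u - z) + real_of_ereal (h u)" if u: "u \<in> eff_dom C h" for u
      by (subst real[OF z], subst real[OF u]) (simp add: zero_ereal_def)
    have "eff_dom C h \<subseteq> C" by (auto simp: eff_dom_def)
    with inf fin show ?thesis by blast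
  qed
  show ?thesis unfolding mvi_solutions_def by (intro Collect_cong conj_cong refl eq)
qed

text \<open>\<open>arg_min_on\<close> is a choice operator, so it yields a minimiser only once some
  minimiser \<open>q\<close> is known. Since the objective is finite at \<open>q\<close>, the chosen
  point also lies in the effective domain.\<close>

lemma prox_minimises:
  fixes u :: "'a::real_inner"
  assumes h: "proper_on C h" and lam: "0 < lam"
    and q: "q \<in> eff_dom C h"
    and min: "\<And>v. v \<in> eff_dom C h \<Longrightarrow>
      lam * real_of_ereal (h q) + (norm (u - q))\<^sup>2 / 2 \<le> lam * real_of_ereal (h v) + (norm (u - v))\<^sup>2 / 2"
  defines "p \<equiv> prox C lam h u"
  shows "p \<in> eff_dom C h"
    and "v \<in> eff_dom C h \<Longrightarrow>
      lam * real_of_ereal (h p) + (norm (u - p))\<^sup>2 / 2 \<le> lam * real_of_ereal (h v) + (norm (u - v))\<^sup>2 / 2"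
proof -
  define F where "F v = ereal lam * h v + ereal ((norm (u - v))\<^sup>2 / 2)" for v
  have fin: "F v = ereal (lam * real_of_ereal (h v) + (norm (u - v))\<^sup>2 / 2)" if "v \<in> eff_dom C h" for v
    unfolding F_def by (subst proper_on_eff_dom_ereal[OF h that]) simp
  have inf: "F v = \<infinity>" if "v \<in> C" "v \<notin> eff_dom C h" for v
  proof -
    have "h v = \<infinity>" using that by (simp add: eff_dom_def)
    then show ?thesis using lam by (simp add: F_def)
  qed
  have sub: "v \<in> C" if "v \<in> eff_dom C h" for v using that by (simp add: eff_dom_def)
  have "F q \<le> F v" if "v \<in> C" for v
    using min[of v] fin[OF q] fin[of v] inf[OF that] by (cases "v \<in> eff_dom C h") auto
  then have "is_arg_min F (\<lambda>v. v \<in> C) q"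
    using sub[OF q] by (auto simp: is_arg_min_def not_less)
  then have "is_arg_min F (\<lambda>v. v \<in> C) p"
    unfolding p_def prox_def arg_min_on_def arg_min_def F_def by (rule someI)
  then have p: "p \<in> C" "\<And>v. v \<in> C \<Longrightarrow> F p \<le> F v" by (auto simp: is_arg_min_def not_less)
  show pD: "p \<in> eff_dom C h"
  proof (rule ccontr)
    assume "p \<notin> eff_dom C h"
    then have "F p = \<infinity>" using p(1) by (intro inf)
    then show False using p(2)[OF sub[OF q]] fin[OF q] by simp
  qed
  show "lam * real_of_ereal (h p) + (norm (u - p))\<^sup>2 / 2 \<le> lam * real_of_ereal (h v) + (norm (u - v))\<^sup>2 / 2"
    if "v \<in> eff_dom C h"
    using p(2)[OF sub[OF that]] fin[OF pD] fin[OF that] by simp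
qed

theorem theorem3p6:
  fixes C :: "'a::{real_inner, complete_space} set"
    and T :: "'a \<Rightarrow> 'a"
    and h :: "'a \<Rightarrow> ereal"
    and \<beta> lam :: real
    and x\<^sub>0 :: 'a
    and x y :: "real \<Rightarrow> 'a"
  assumes "C \<noteq> {}" and "closed C" and "convex C"
    and "mvi_solutions C T h \<noteq> {}"
    and "\<beta> > 0" and "\<beta>-lipschitz_on UNIV T"
    and "proper_on C h" and "lsc_on C h" and "ereal_convex_on C h"
    and "monotone_operator_on C T"
    and "seq_weakly_continuous_on C T"
    and "0 < lam" and "lam < 1 / (1 + \<beta>\<^sup>2)"
    and "strong_global_solution C T h lam x\<^sub>0 x y"
  shows "\<exists>z \<in> mvi_solutions C T h. weakly_converges x z at_top \<and> weakly_converges y z at_top"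
proof -
  define D where "D = eff_dom C h"
  define g where "g v = real_of_ereal (h v)" for v
  note sol = mvi_solutions_real[OF \<open>proper_on C h\<close>, of T, folded D_def g_def]
  have real: "h v = ereal (g v)" if "v \<in> D" for v
    using proper_on_eff_dom_ereal[OF \<open>proper_on C h\<close>, of v] that unfolding D_def g_def .
  have sub: "D \<subseteq> C" by (auto simp: D_def eff_dom_def)
  have g_convex: "convex_on D g"
    using ereal_convex_on_real[OF \<open>proper_on C h\<close> \<open>ereal_convex_on C h\<close>] by (simp add: D_def g_def[abs_def])
  have g_closed: "closed {v \<in> D. g v \<le> c v}" if "continuous_on UNIV c" for c
  proof -
    have "h v \<le> ereal (c v) \<longleftrightarrow> g v \<le> c v" if "v \<in> D" for v
      unfolding real[OF that] by simp
    moreover have "v \<in> D" if "v \<in> C" "h v \<le> ereal (c v)" for v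
      using that le_less_trans[of "h v" "ereal (c v)" \<infinity>] by (simp add: D_def eff_dom_def)
    ultimately have "{v \<in> D. g v \<le> c v} = {v \<in> C. h v \<le> ereal (c v)}"
      using sub by blast
    then show ?thesis
      using lsc_on_closed_sublevel[OF \<open>closed C\<close> \<open>lsc_on C h\<close> that] by simp
  qed
  obtain z where z: "z \<in> D" "\<And>u. u \<in> D \<Longrightarrow> g z \<le> T z \<bullet> (u - z) + g u"
    using \<open>mvi_solutions C T h \<noteq> {}\<close> unfolding sol by blast
  \<comment> \<open>The variational inequality of any solution is itself an affine minorant of
    \<open>g\<close>.\<close>
  have minorant: "(g z + T z \<bullet> z) + (- T z) \<bullet> u \<le> g u" if "u \<in> D" for u
    using z(2)[OF that] by (simp add: inner_diff_right)
  have prox: "prox C lam h u \<in> D \<and> (\<forall>v\<in>D. lam * g (prox C lam h u) + (norm (u - prox C lam h u))\<^sup>2 / 2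
      \<le> lam * g v + (norm (u - v))\<^sup>2 / 2)" for u
  proof -
    obtain q where "q \<in> D" "\<And>v. v \<in> D \<Longrightarrow> lam * g q + (norm (u - q))\<^sup>2 / 2 \<le> lam * g v + (norm (u - v))\<^sup>2 / 2"
      using proximal_point_exists[OF g_convex _ g_closed minorant \<open>0 < lam\<close>] z(1) by blast
    from prox_minimises[OF \<open>proper_on C h\<close> \<open>0 < lam\<close> this[unfolded D_def g_def]]
    show ?thesis unfolding D_def g_def by blast
  qed
  have "lam * \<beta> < 1"
  proof -
    have "lam * (1 + \<beta>\<^sup>2) < 1"
      using \<open>lam < 1 / (1 + \<beta>\<^sup>2)\<close> by (simp add: pos_less_divide_eq add_pos_nonneg)
    \<comment> \<open>From \<open>(\<beta> - 1)\<^sup>2 \<ge> 0\<close> one even gets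
      \<open>2 * \<beta> \<le> 1 + \<beta>\<^sup>2\<close>.\<close>
    moreover have "\<beta> \<le> 1 + \<beta>\<^sup>2"
      using zero_le_power2[of "\<beta> - 1"] \<open>\<beta> > 0\<close> by (simp add: power2_diff)
    then have "lam * \<beta> \<le> lam * (1 + \<beta>\<^sup>2)" using \<open>0 < lam\<close> by simp
    ultimately show ?thesis by linarith
  qed
  have y_eq: "y t = prox C lam h (x t - lam *\<^sub>R T (x t))" if "0 \<le> t" for t
    using \<open>strong_global_solution C T h lam x\<^sub>0 x y\<close> that by (simp add: strong_global_solution_def)
  have "AE t in lebesgue_on {0..}. (x has_vector_derivative (y t - x t + lam *\<^sub>R (T (x t) - T (y t)))) (at t within {0..})"
  proof -
    have "AE t in lebesgue_on {0..}. \<exists>x'. (x has_vector_derivative x') (at t within {0..}) \<and>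
        x' + x t = y t + lam *\<^sub>R (T (x t) - T (y t))"
      using \<open>strong_global_solution C T h lam x\<^sub>0 x y\<close> by (simp add: strong_global_solution_def)
    then show ?thesis
    proof (rule AE_mp, intro AE_I2 impI, elim exE conjE)
      fix t x' assume d: "(x has_vector_derivative x') (at t within {0..})"
        and "x' + x t = y t + lam *\<^sub>R (T (x t) - T (y t))"
      then have "x' = y t - x t + lam *\<^sub>R (T (x t) - T (y t))" by (simp add: algebra_simps)
      with d show "(x has_vector_derivative (y t - x t + lam *\<^sub>R (T (x t) - T (y t)))) (at t within {0..})"
        by simp
    qed
  qed
  then have "AE t in lebesgue. t \<in> {0..} \<longrightarrow>
      (x has_vector_derivative (y t - x t + lam *\<^sub>R (T (x t) - T (y t)))) (at t within {0..})"
    by (subst (asm) AE_restrict_space_iff) auto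
  \<comment> \<open>One null set containing all exceptional times, as the locale requires.\<close>
  then obtain N where N: "N \<in> null_sets lebesgue"
    "{t \<in> space lebesgue. \<not> (t \<in> {0..} \<longrightarrow>
      (x has_vector_derivative (y t - x t + lam *\<^sub>R (T (x t) - T (y t)))) (at t within {0..}))} \<subseteq> N"
    unfolding eventually_ae_filter by blast
  interpret forward_backward_forward_flow D g T \<beta> lam x y N
  proof
    show "convex_on D g" by (rule g_convex)
    show "closed {v \<in> D. g v \<le> c v}" if "continuous_on UNIV c" for c using that by (rule g_closed)
    show "\<beta>-lipschitz_on UNIV T" "0 < lam" "lam * \<beta> < 1" by fact+
    show "0 \<le> (T u - T v) \<bullet> (u - v)" if "u \<in> D" "v \<in> D" for u v
      using \<open>monotone_operator_on C T\<close> that sub by (auto simp: monotone_operator_on_def)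
    show "y t \<in> D" if "0 \<le> t" for t using prox y_eq[OF that] by simp
    show "(x t - lam *\<^sub>R T (x t) - y t) \<bullet> (w - y t) \<le> lam * (g w - g (y t))"
      if "0 \<le> t" "w \<in> D" for t w
      using prox[of "x t - lam *\<^sub>R T (x t)"] that(2) unfolding y_eq[OF that(1), symmetric]
      by (intro proximal_variational_inequality[OF g_convex _ _ \<open>0 < lam\<close>]) auto
    show "locally_absolutely_continuous x"
      using \<open>strong_global_solution C T h lam x\<^sub>0 x y\<close> by (simp add: strong_global_solution_def)
    show "negligible N" using N(1) by (simp add: negligible_iff_null_sets)
    show "(x has_vector_derivative (y t - x t + lam *\<^sub>R (T (x t) - T (y t)))) (at t within {0..})"
      if "0 \<le> t" "t \<notin> N" for t
      using N(2) that by auto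
  qed
  have "solutions = mvi_solutions C T h" unfolding sol solutions_def ..
  then show ?thesis using weak_convergence \<open>mvi_solutions C T h \<noteq> {}\<close> by simp
qed

end
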